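(* There is an absolute constant $c>0$ such that the following holds for the online convex covering problem. Let $f:\mathbb{R}_+^n\to\mathbb{R}_+$ be a convex multivariate polynomial with non-negative coefficients, maximum degree $\tau\ge 1$ and $f(\vec 0)=0$. (a) If $f$ is a homogeneous polynomial (of degree $\tau$) and $n\ge 2$, then there is a $(c\,\tau\log n)^\tau$-competitive online algorithm for online convex covering with cost function $f$. (b) If $f$ is a sum of $N\ge 2$ monomials, then there is a $(c\,\tau\log N)^\tau$-competitive online algorithm for online convex covering with cost function $f$.
   Context: Online convex covering problem with cost function $f:\mathbb{R}_+^n\to\mathbb{R}_+$: the number $n$ and the function $f$ are known in advance. The algorithm maintains $\vec x\in\mathbb{R}_+^n$ whose coordinates may only increase over time. In round $k=1,\dots,m$ a nonzero vector $\vec a_k\in\mathbb{R}_+^n$ arrives (possibly chosen adversarially depending on the algorithm's past responses), and the algorithm must immediately, without knowledge of future vectors (or of $m$), increase coordinates of $\vec x$ so that $\langle\vec a_k,\vec x\rangle\ge 1$. Let $C^{\mathrm{opt}}$ be the minimum of $f(\vec x)$ over all $\vec x\in\mathbb{R}_+^n$ with $\langle\vec a_k,\vec x\rangle\ge1$ for all $k\in[m]$. The algorithm is $\alpha$-competitive if for every instance its final vector $\vec x$ satisfies $f(\vec x)\le\alpha\cdot C^{\mathrm{opt}}$. A monomial is a term $c_{\vec d}\prod_i x_i^{d_i}$ with $c_{\vec d}>0$. *)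

theory Defs
  imports Complex_Main "HOL-Library.Poly_Mapping" "Jordan_Normal_Form.Matrix"
begin

(* A real multivariate polynomial in the variables x_0, x_1, ... is a finitely supported map
   from exponent vectors to coefficients; its keys are the monomials that occur in it. *)
type_synonym real_mpoly = "(nat \<Rightarrow>\<^sub>0 nat) \<Rightarrow>\<^sub>0 real"

definition mpoly_eval :: "real_mpoly \<Rightarrow> real vec \<Rightarrow> real" where
  "mpoly_eval p x = (\<Sum>d\<in>Poly_Mapping.keys p. Poly_Mapping.lookup p d *
     (\<Prod>i\<in>Poly_Mapping.keys d. (x $ i) ^ Poly_Mapping.lookup d i))"

definition in_variables :: "nat \<Rightarrow> real_mpoly \<Rightarrow> bool" where
  "in_variables n p \<longleftrightarrow> (\<forall>d\<in>Poly_Mapping.keys p. Poly_Mapping.keys d \<subseteq> {..<n})"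

definition nonneg_coeffs :: "real_mpoly \<Rightarrow> bool" where
  "nonneg_coeffs p \<longleftrightarrow> (\<forall>d. 0 \<le> Poly_Mapping.lookup p d)"

definition exponent_degree :: "(nat \<Rightarrow>\<^sub>0 nat) \<Rightarrow> nat" where
  "exponent_degree d = (\<Sum>i\<in>Poly_Mapping.keys d. Poly_Mapping.lookup d i)"

(* The zero polynomial gets degree 0. *)
definition max_degree :: "real_mpoly \<Rightarrow> nat" where
  "max_degree p = Max (insert 0 (exponent_degree ` Poly_Mapping.keys p))"

definition homogeneous :: "nat \<Rightarrow> real_mpoly \<Rightarrow> bool" where
  "homogeneous \<tau> p \<longleftrightarrow> (\<forall>d\<in>Poly_Mapping.keys p. exponent_degree d = \<tau>)"

definition num_monomials :: "real_mpoly \<Rightarrow> nat" where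
  "num_monomials p = card (Poly_Mapping.keys p)"

definition orthant :: "nat \<Rightarrow> real vec set" where
  "orthant n = {x \<in> carrier_vec n. 0\<^sub>v n \<le> x}"

(* The inequality of the library predicate convex_on, which is not available here because
   the type of vectors of arbitrary dimension is not a real vector space. *)
definition convex_on_orthant :: "nat \<Rightarrow> (real vec \<Rightarrow> real) \<Rightarrow> bool" where
  "convex_on_orthant n f \<longleftrightarrow>
     (\<forall>x\<in>orthant n. \<forall>y\<in>orthant n. \<forall>u\<ge>0. \<forall>v\<ge>0. u + v = 1 \<longrightarrow>
        f (u \<cdot>\<^sub>v x + v \<cdot>\<^sub>v y) \<le> u * f x + v * f y)"

(* An instance is the list of arriving vectors, in order of arrival. *)
definition covering_instances :: "nat \<Rightarrow> real vec list set" where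
  "covering_instances n = {as. \<forall>a\<in>set as. a \<in> orthant n \<and> a \<noteq> 0\<^sub>v n}"

definition feasible :: "nat \<Rightarrow> real vec list \<Rightarrow> real vec set" where
  "feasible n as = {x \<in> orthant n. \<forall>a\<in>set as. 1 \<le> a \<bullet> x}"

(* The feasible set is nonempty and f is nonnegative in the intended use, so this infimum is
   a genuine one; it equals the minimum of f over the feasible set. *)
definition opt_cost :: "nat \<Rightarrow> (real vec \<Rightarrow> real) \<Rightarrow> real vec list \<Rightarrow> real" where
  "opt_cost n f as = (INF x\<in>feasible n as. f x)"

(* A deterministic online algorithm maps the list of vectors seen so far to its current
   solution; that it sees neither future vectors nor their number is built into the type.
   Since A is deterministic, an adversary that adapts to the past responses of A is
   no stronger than one that fixes the list of vectors in advance. *)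
definition online_algorithm :: "nat \<Rightarrow> (real vec list \<Rightarrow> real vec) \<Rightarrow> bool" where
  "online_algorithm n A \<longleftrightarrow>
     (\<forall>as\<in>covering_instances n. A as \<in> orthant n) \<and>
     (\<forall>as a. as @ [a] \<in> covering_instances n \<longrightarrow>
        A as \<le> A (as @ [a]) \<and> 1 \<le> a \<bullet> A (as @ [a]))"

definition competitive ::
  "nat \<Rightarrow> (real vec \<Rightarrow> real) \<Rightarrow> real \<Rightarrow> (real vec list \<Rightarrow> real vec) \<Rightarrow> bool" where
  "competitive n f \<alpha> A \<longleftrightarrow>
     online_algorithm n A \<and>
     (\<forall>as\<in>covering_instances n. f (A as) \<le> \<alpha> * opt_cost n f as)"

end

theory Submission
  imports Defs
begin

text \<open>
  Let \<open>J\<close> be the set of variables that occur in the polynomial \<open>F\<close>. Convexity forces a pure power of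
  every variable in \<open>J\<close> to occur, so \<open>J\<close> has at most \<open>N\<close> as well as at most \<open>n\<close> elements, and it
  suffices to be \<open>(c \<tau> ln M) ^ \<tau>\<close>-competitive whenever \<open>card J \<le> M\<close>.

  Given a guess \<open>G\<close> of the optimum, let \<open>u j\<close> be the point of the \<open>j\<close>-th axis where \<open>F\<close> has value
  \<open>G\<close>. Starting from \<open>u / M\<close>, multiply \<open>x j\<close> by \<open>1 + \<eta> a j / grad (\<delta> x) j\<close>, for those \<open>j\<close> with
  \<open>x j < u j\<close>, until the arriving vector \<open>a\<close> is covered. The dual value collected on the way is
  comparable to \<open>F (\<delta> x) / \<delta>\<close> and, because the gradient is monotone and every coordinate grows by
  a factor of at most \<open>2 M\<close>, it is at most \<open>O(ln M)\<close> times the inner product of \<open>grad (\<delta> x)\<close> with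
  any competitor \<open>z\<close>. For \<open>1 / \<delta>\<close> of order \<open>\<tau> ln M\<close> the gradient inequality between \<open>\<delta> x\<close> and \<open>z\<close>
  then yields \<open>F (\<delta> x) \<le> 2 G\<close>. Using the gradient at \<open>\<delta> x\<close> rather than at \<open>x\<close> avoids having to
  compare the two gradients, which differ by a fixed power of \<open>\<delta>\<close> only for homogeneous \<open>F\<close>. The
  guess \<open>G\<close> runs through the powers of \<open>2 ^ \<tau>\<close>.
\<close>

lemma online_choice:
  fixes Q :: "'a list \<Rightarrow> 's \<Rightarrow> bool" and R :: "'a \<Rightarrow> 's \<Rightarrow> 's \<Rightarrow> bool"
  assumes init: "Q [] s0"
    and step: "\<And>as a s. \<forall>b\<in>set (as @ [a]). V b \<Longrightarrow> Q as s \<Longrightarrow> \<exists>t. Q (as @ [a]) t \<and> R a s t"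
  shows "\<exists>B. (\<forall>as. (\<forall>b\<in>set as. V b) \<longrightarrow> Q as (B as)) \<and>
    (\<forall>as a. (\<forall>b\<in>set (as @ [a]). V b) \<longrightarrow> R a (B as) (B (as @ [a])))"
proof -
  define C where "C = rec_list s0 (\<lambda>a as s. SOME t. Q (rev as @ [a]) t \<and> R a s t)"
  have C: "Q (rev as) (C as)" if "\<forall>b\<in>set as. V b" for as
    using that
  proof (induction as)
    case Nil
    then show ?case by (simp add: C_def init)
  next
    case (Cons a as)
    have "\<exists>t. Q (rev as @ [a]) t \<and> R a (C as) t"
      by (rule step) (use Cons in auto)
    from someI_ex[OF this] show ?case by (simp add: C_def)
  qed
  have R: "R a (C (rev as)) (C (a # rev as))" if "\<forall>b\<in>set (as @ [a]). V b" for as a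
  proof -
    have "\<exists>t. Q (as @ [a]) t \<and> R a (C (rev as)) t"
      by (rule step) (use that C[of "rev as"] in auto)
    from someI_ex[OF this] show ?thesis by (simp add: C_def)
  qed
  show ?thesis
    using C[of "rev _"] R by (intro exI[of _ "\<lambda>as. C (rev as)"]) auto
qed

section \<open>Convex polynomials with positive coefficients\<close>

locale convex_posynomial =
  fixes K :: "'k set" and J :: "'i set" and c :: "'k \<Rightarrow> real" and e :: "'k \<Rightarrow> 'i \<Rightarrow> nat" and \<tau> :: nat
  fixes F :: "('i \<Rightarrow> real) \<Rightarrow> real"
  assumes F_def: "F x = (\<Sum>k\<in>K. c k * (\<Prod>j\<in>J. x j ^ e k j))"
    and finite_K: "finite K" and finite_J: "finite J"
    and c_pos: "k \<in> K \<Longrightarrow> 0 < c k"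
    and degree_le: "k \<in> K \<Longrightarrow> (\<Sum>j\<in>J. e k j) \<le> \<tau>"
    and non_constant: "k \<in> K \<Longrightarrow> \<exists>j\<in>J. 0 < e k j"
    and occurs: "j \<in> J \<Longrightarrow> \<exists>k\<in>K. 0 < e k j"
    and degree_pos: "1 \<le> \<tau>"
    and convex: "\<lbrakk>\<And>j. j \<in> J \<Longrightarrow> 0 \<le> x j; \<And>j. j \<in> J \<Longrightarrow> 0 \<le> y j; 0 \<le> u; 0 \<le> v; u + v = 1\<rbrakk>
      \<Longrightarrow> F (\<lambda>j. u * x j + v * y j) \<le> u * F x + v * F y"
begin

text \<open>If \<open>e k j = 0\<close>, the truncated exponent is harmless because of the factor \<open>e k j\<close>.\<close>

definition grad :: "('i \<Rightarrow> real) \<Rightarrow> 'i \<Rightarrow> real" where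
  "grad x j = (\<Sum>k\<in>K. c k * e k j * (\<Prod>i\<in>J. x i ^ (e k i - (if i = j then 1 else 0))))"

lemma F_cong: "(\<And>j. j \<in> J \<Longrightarrow> x j = y j) \<Longrightarrow> F x = F y"
  unfolding F_def by (intro sum.cong refl arg_cong2[of _ _ _ _ "(*)"] prod.cong) auto

lemma F_mono:
  assumes "\<And>j. j \<in> J \<Longrightarrow> 0 \<le> x j" "\<And>j. j \<in> J \<Longrightarrow> x j \<le> y j"
  shows "F x \<le> F y"
  unfolding F_def
  by (intro sum_mono mult_left_mono prod_mono) (use assms c_pos in \<open>auto intro: power_mono less_imp_le\<close>)

lemma F_zero: "F (\<lambda>_. 0) = 0"
proof -
  have "(\<Prod>j\<in>J. (0::real) ^ e k j) = 0" if "k \<in> K" for k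
    using non_constant[OF that] finite_J by auto
  then show ?thesis by (simp add: F_def)
qed

lemma F_nonneg:
  assumes "\<And>j. j \<in> J \<Longrightarrow> 0 \<le> x j"
  shows "0 \<le> F x"
  using F_mono[of "\<lambda>_. 0" x] assms F_zero by auto

lemma F_scale_le:
  assumes "\<And>j. j \<in> J \<Longrightarrow> 0 \<le> x j" "1 \<le> t"
  shows "F (\<lambda>j. t * x j) \<le> t ^ \<tau> * F x"
proof -
  have "(\<Prod>j\<in>J. (t * x j) ^ e k j) \<le> t ^ \<tau> * (\<Prod>j\<in>J. x j ^ e k j)" if "k \<in> K" for k
  proof -
    have "(\<Prod>j\<in>J. (t * x j) ^ e k j) = t ^ (\<Sum>j\<in>J. e k j) * (\<Prod>j\<in>J. x j ^ e k j)"
      by (simp add: power_mult_distrib prod.distrib power_sum)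
    also have "\<dots> \<le> t ^ \<tau> * (\<Prod>j\<in>J. x j ^ e k j)"
      using assms degree_le[OF that] by (intro mult_right_mono power_increasing prod_nonneg) auto
    finally show ?thesis .
  qed
  then have "F (\<lambda>j. t * x j) \<le> (\<Sum>k\<in>K. c k * (t ^ \<tau> * (\<Prod>j\<in>J. x j ^ e k j)))"
    unfolding F_def by (intro sum_mono mult_left_mono) (auto intro: less_imp_le c_pos)
  also have "\<dots> = t ^ \<tau> * F x" by (simp add: F_def sum_distrib_left algebra_simps)
  finally show ?thesis .
qed

lemma F_shrink_le:
  assumes "\<And>j. j \<in> J \<Longrightarrow> 0 \<le> x j" "0 \<le> t" "t \<le> 1"
  shows "F (\<lambda>j. t * x j) \<le> t * F x"
  using convex[of x "\<lambda>_. 0" t "1 - t"] assms F_zero by simp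

lemma F_add_le:
  assumes "\<And>j. j \<in> J \<Longrightarrow> 0 \<le> x j" "\<And>j. j \<in> J \<Longrightarrow> 0 \<le> y j"
  shows "F (\<lambda>j. x j + y j) \<le> 2 ^ \<tau> / 2 * (F x + F y)"
proof -
  have "F (\<lambda>j. x j + y j) \<le> 1/2 * F (\<lambda>j. 2 * x j) + 1/2 * F (\<lambda>j. 2 * y j)"
    using convex[of "\<lambda>j. 2 * x j" "\<lambda>j. 2 * y j" "1/2" "1/2"] assms by simp
  also have "\<dots> \<le> 1/2 * (2 ^ \<tau> * F x) + 1/2 * (2 ^ \<tau> * F y)"
    by (intro add_mono mult_left_mono F_scale_le) (use assms in auto)
  finally show ?thesis by (simp add: algebra_simps)
qed

lemma coeff_nonneg: "k \<in> K \<Longrightarrow> 0 \<le> c k * real (e k j)"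
  using c_pos[of k] by simp

lemma grad_nonneg:
  assumes "\<And>j. j \<in> J \<Longrightarrow> 0 \<le> x j"
  shows "0 \<le> grad x j"
  unfolding grad_def using assms
  by (intro sum_nonneg mult_nonneg_nonneg prod_nonneg) (auto intro: less_imp_le c_pos)

lemma grad_mono:
  assumes "\<And>j. j \<in> J \<Longrightarrow> 0 \<le> x j" "\<And>j. j \<in> J \<Longrightarrow> x j \<le> y j"
  shows "grad x j \<le> grad y j"
  unfolding grad_def
  by (intro sum_mono mult_left_mono prod_mono)
     (use assms in \<open>auto intro: power_mono coeff_nonneg\<close>)

lemma grad_pos:
  assumes "\<And>j. j \<in> J \<Longrightarrow> 0 < x j" "j \<in> J"
  shows "0 < grad x j"
proof -
  obtain k where k: "k \<in> K" "0 < e k j" using occurs assms by blast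
  show ?thesis unfolding grad_def
  proof (rule sum_pos2[OF finite_K k(1)])
    show "0 < c k * e k j * (\<Prod>i\<in>J. x i ^ (e k i - (if i = j then 1 else 0)))"
      using k c_pos assms by (intro mult_pos_pos prod_pos) auto
    show "0 \<le> c i * e i j * (\<Prod>l\<in>J. x l ^ (e i l - (if l = j then 1 else 0)))" if "i \<in> K" for i
      using that c_pos assms by (intro mult_nonneg_nonneg prod_nonneg) (auto intro: less_imp_le)
  qed
qed

lemma grad_scale_le:
  assumes "\<And>j. j \<in> J \<Longrightarrow> 0 \<le> x j" "1 \<le> t"
  shows "grad (\<lambda>j. t * x j) j \<le> t ^ \<tau> * grad x j"
proof -
  have "(\<Prod>i\<in>J. (t * x i) ^ (e k i - (if i = j then 1 else 0)))
      \<le> t ^ \<tau> * (\<Prod>i\<in>J. x i ^ (e k i - (if i = j then 1 else 0)))" if "k \<in> K" for k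
  proof -
    let ?d = "\<lambda>i. e k i - (if i = j then 1 else 0)"
    have "(\<Prod>i\<in>J. (t * x i) ^ ?d i) = t ^ (\<Sum>i\<in>J. ?d i) * (\<Prod>i\<in>J. x i ^ ?d i)"
      by (simp add: power_mult_distrib prod.distrib power_sum)
    also have "\<dots> \<le> t ^ \<tau> * (\<Prod>i\<in>J. x i ^ ?d i)"
      using assms sum_mono[of J ?d "e k"] degree_le[OF that]
      by (intro mult_right_mono power_increasing prod_nonneg) auto
    finally show ?thesis .
  qed
  then have "grad (\<lambda>j. t * x j) j \<le> (\<Sum>k\<in>K. c k * e k j *
      (t ^ \<tau> * (\<Prod>i\<in>J. x i ^ (e k i - (if i = j then 1 else 0)))))"
    unfolding grad_def
    by (intro sum_mono mult_left_mono) (auto intro: coeff_nonneg)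
  also have "\<dots> = t ^ \<tau> * grad x j" by (simp add: grad_def sum_distrib_left algebra_simps)
  finally show ?thesis .
qed

lemma monomial_Euler:
  fixes x :: "'i \<Rightarrow> real"
  assumes "j \<in> J"
  shows "e k j * (\<Prod>i\<in>J. x i ^ (e k i - (if i = j then 1 else 0))) * x j
    = e k j * (\<Prod>i\<in>J. x i ^ e k i)"
proof -
  have "(\<Prod>i\<in>J - {j}. x i ^ (e k i - (if i = j then 1 else 0))) = (\<Prod>i\<in>J - {j}. x i ^ e k i)"
    by (rule prod.cong) auto
  moreover have "x j ^ (e k j - 1) * x j = x j ^ e k j" if "e k j \<noteq> 0"
    using that power_minus_mult[of "e k j" "x j"] by simp
  ultimately show ?thesis
    using prod.remove[OF finite_J assms, of "\<lambda>i. x i ^ (e k i - (if i = j then 1 else 0))"]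
      prod.remove[OF finite_J assms, of "\<lambda>i. x i ^ e k i"]
    by (cases "e k j = 0") (simp_all add: mult.commute mult.left_commute)
qed

lemma grad_Euler_le:
  assumes "\<And>j. j \<in> J \<Longrightarrow> 0 \<le> x j"
  shows "(\<Sum>j\<in>J. grad x j * x j) \<le> \<tau> * F x"
proof -
  have "(\<Sum>j\<in>J. grad x j * x j)
      = (\<Sum>j\<in>J. \<Sum>k\<in>K. c k * (e k j * (\<Prod>i\<in>J. x i ^ (e k i - (if i = j then 1 else 0))) * x j))"
    by (simp add: grad_def sum_distrib_right mult.assoc)
  also have "\<dots> = (\<Sum>j\<in>J. \<Sum>k\<in>K. c k * (e k j * (\<Prod>i\<in>J. x i ^ e k i)))"
    by (intro sum.cong refl) (simp only: monomial_Euler)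
  also have "\<dots> = (\<Sum>k\<in>K. \<Sum>j\<in>J. c k * (e k j * (\<Prod>i\<in>J. x i ^ e k i)))"
    by (rule sum.swap)
  also have "\<dots> = (\<Sum>k\<in>K. real (\<Sum>j\<in>J. e k j) * (c k * (\<Prod>i\<in>J. x i ^ e k i)))"
    by (simp add: sum_distrib_right sum_distrib_left algebra_simps)
  also have "\<dots> \<le> (\<Sum>k\<in>K. real \<tau> * (c k * (\<Prod>i\<in>J. x i ^ e k i)))"
    by (intro sum_mono mult_right_mono of_nat_mono degree_le mult_nonneg_nonneg prod_nonneg zero_le_power)
       (auto intro: less_imp_le c_pos assms)
  also have "\<dots> = \<tau> * F x" by (simp add: F_def sum_distrib_left)
  finally show ?thesis .
qed

lemma F_has_derivative_along_segment:
  "((\<lambda>t. F (\<lambda>j. x j + t * v j)) has_field_derivative (\<Sum>j\<in>J. grad x j * v j)) (at 0)"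
proof -
  have monomial: "((\<lambda>t. \<Prod>j\<in>J. (x j + t * v j) ^ e k j) has_field_derivative
      (\<Sum>j\<in>J. e k j * (\<Prod>i\<in>J. x i ^ (e k i - (if i = j then 1 else 0))) * v j)) (at 0)" for k
  proof -
    have "((\<lambda>t. \<Prod>j\<in>J. (x j + t * v j) ^ e k j) has_field_derivative
      (\<Sum>j\<in>J. (e k j * (x j + 0 * v j) ^ (e k j - 1) * v j) * (\<Prod>i\<in>J - {j}. (x i + 0 * v i) ^ e k i))) (at 0)"
      by (rule has_field_derivative_prod) (auto intro!: derivative_eq_intros)
    moreover have "(e k j * (x j + 0 * v j) ^ (e k j - 1) * v j) * (\<Prod>i\<in>J - {j}. (x i + 0 * v i) ^ e k i)
        = e k j * (\<Prod>i\<in>J. x i ^ (e k i - (if i = j then 1 else 0))) * v j" if "j \<in> J" for j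
    proof -
      have "(\<Prod>i\<in>J - {j}. x i ^ (e k i - (if i = j then 1 else 0))) = (\<Prod>i\<in>J - {j}. x i ^ e k i)"
        by (rule prod.cong) auto
      then show ?thesis
        using prod.remove[OF finite_J that, of "\<lambda>i. x i ^ (e k i - (if i = j then 1 else 0))"]
        by simp
    qed
    ultimately show ?thesis by (simp only: cong: sum.cong)
  qed
  have "((\<lambda>t. F (\<lambda>j. x j + t * v j)) has_field_derivative
      (\<Sum>k\<in>K. c k * (\<Sum>j\<in>J. e k j * (\<Prod>i\<in>J. x i ^ (e k i - (if i = j then 1 else 0))) * v j))) (at 0)"
    unfolding F_def by (intro DERIV_sum DERIV_cmult monomial)
  also have "(\<Sum>k\<in>K. c k * (\<Sum>j\<in>J. e k j * (\<Prod>i\<in>J. x i ^ (e k i - (if i = j then 1 else 0))) * v j))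
    = (\<Sum>k\<in>K. \<Sum>j\<in>J. c k * e k j * (\<Prod>i\<in>J. x i ^ (e k i - (if i = j then 1 else 0))) * v j)"
    by (simp add: sum_distrib_left algebra_simps)
  also have "\<dots> = (\<Sum>j\<in>J. grad x j * v j)"
    by (subst sum.swap) (simp add: grad_def sum_distrib_right)
  finally show ?thesis .
qed

lemma grad_le:
  assumes x: "\<And>j. j \<in> J \<Longrightarrow> 0 \<le> x j" and y: "\<And>j. j \<in> J \<Longrightarrow> 0 \<le> y j"
  shows "(\<Sum>j\<in>J. grad x j * (y j - x j)) \<le> F y - F x"
proof -
  let ?\<phi> = "\<lambda>t. F (\<lambda>j. x j + t * (y j - x j))"
  have "((\<lambda>t. (?\<phi> (0 + t) - ?\<phi> 0) / t) \<longlongrightarrow> (\<Sum>j\<in>J. grad x j * (y j - x j))) (at 0)"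
    using F_has_derivative_along_segment[of x "\<lambda>j. y j - x j"] by (simp only: DERIV_def)
  then have lim: "((\<lambda>t. (?\<phi> t - F x) / t) \<longlongrightarrow> (\<Sum>j\<in>J. grad x j * (y j - x j))) (at_right 0)"
    by (auto intro: tendsto_mono[OF at_le])
  have "\<forall>\<^sub>F t in at_right 0. (?\<phi> t - F x) / t \<le> F y - F x"
    unfolding eventually_at_right_field
  proof (intro exI[of _ 1] conjI allI impI)
    fix t :: real assume t: "0 < t" "t < 1"
    have "?\<phi> t = F (\<lambda>j. (1 - t) * x j + t * y j)"
      by (rule F_cong) (simp add: algebra_simps)
    also have "\<dots> \<le> (1 - t) * F x + t * F y"
      by (rule convex) (use x y t in auto)
    finally show "(?\<phi> t - F x) / t \<le> F y - F x"
      using t by (simp add: field_simps)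
  qed simp
  with lim show ?thesis
    by (rule tendsto_upperbound) simp
qed

section \<open>Covering constraints\<close>

definition covering_row :: "('i \<Rightarrow> real) \<Rightarrow> bool" where
  "covering_row a \<longleftrightarrow> (\<forall>j\<in>J. 0 \<le> a j) \<and> (\<exists>j\<in>J. 0 < a j)"

definition covers :: "('i \<Rightarrow> real) list \<Rightarrow> ('i \<Rightarrow> real) \<Rightarrow> bool" where
  "covers as z \<longleftrightarrow> (\<forall>j\<in>J. 0 \<le> z j) \<and> (\<forall>a\<in>set as. 1 \<le> (\<Sum>j\<in>J. a j * z j))"

lemma row_satisfiable:
  assumes "covering_row a" "\<And>j. j \<in> J \<Longrightarrow> 0 \<le> x j"
  shows "\<exists>y. (\<forall>j\<in>J. x j \<le> y j) \<and> 1 \<le> (\<Sum>j\<in>J. a j * y j)"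
proof -
  obtain i where i: "i \<in> J" "0 < a i" and a: "\<And>j. j \<in> J \<Longrightarrow> 0 \<le> a j"
    using assms by (auto simp: covering_row_def)
  let ?y = "\<lambda>j. x j + (if j = i then 1 / a i else 0)"
  have "1 \<le> a i * ?y i" using i assms(2)[of i] by (simp add: field_simps)
  also have "\<dots> \<le> (\<Sum>j\<in>J. a j * ?y j)"
    by (rule member_le_sum) (use i finite_J a assms(2) in auto)
  finally show ?thesis using i by (intro exI[of _ ?y]) auto
qed

lemma axis_value_exists:
  assumes "j \<in> J" "0 < G"
  shows "\<exists>t>0. F (\<lambda>i. if i = j then t else 0) = G"
proof -
  let ?h = "\<lambda>t. F (\<lambda>i. if i = j then t else 0)" and ?g = "grad (\<lambda>_. 1)"
  define s where "s = ((\<Sum>i\<in>J. ?g i) + G) / ?g j"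
  have g: "0 < ?g j" using assms by (intro grad_pos) auto
  have s: "0 \<le> s" unfolding s_def
    using g assms by (intro divide_nonneg_pos add_nonneg_nonneg sum_nonneg grad_nonneg) auto
  have "(\<Sum>i\<in>J. ?g i * ((if i = j then s else 0) - 1)) \<le> ?h s - F (\<lambda>_. 1)"
    using s by (intro grad_le) auto
  moreover have "(\<Sum>i\<in>J. ?g i * ((if i = j then s else 0) - 1)) = ?g j * s - (\<Sum>i\<in>J. ?g i)"
    using finite_J assms(1)
    by (simp add: right_diff_distrib sum_subtractf if_distrib[where f = "\<lambda>t. _ * t"] cong: if_cong)
  moreover have "?g j * s = (\<Sum>i\<in>J. ?g i) + G" using g by (simp add: s_def)
  ultimately have "G \<le> ?h s" using F_nonneg[of "\<lambda>_. 1"] by simp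
  moreover have "?h 0 = 0" using F_zero by simp
  moreover have "continuous_on {0..s} ?h"
    unfolding F_def
  proof (intro continuous_intros)
    fix k i show "continuous_on {0..s} (\<lambda>t. (if i = j then t else 0 :: real))"
      by (cases "i = j") (auto intro: continuous_intros)
  qed
  ultimately obtain t where "0 \<le> t" "?h t = G"
    using IVT'[of ?h 0 G s] s assms(2) by auto
  moreover from this have "t \<noteq> 0" using \<open>?h 0 = 0\<close> assms(2) by auto
  ultimately show ?thesis by (intro exI[of _ t]) auto
qed

lemma le_axis_value:
  assumes "j \<in> J" "0 < t" and axis: "F (\<lambda>i. if i = j then t else 0) = G" and "0 < G"
    and z: "\<And>j. j \<in> J \<Longrightarrow> 0 \<le> z j" "F z \<le> G"
  shows "z j \<le> t"
proof (rule ccontr)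
  assume "\<not> z j \<le> t"
  then have zj: "t < z j" by simp
  have "G = F (\<lambda>i. t / z j * (if i = j then z j else 0))"
    unfolding axis[symmetric] by (rule F_cong) (use zj assms(2) in auto)
  also have "\<dots> \<le> t / z j * F (\<lambda>i. if i = j then z j else 0)"
    by (rule F_shrink_le) (use zj assms(2) in auto)
  also have "\<dots> \<le> t / z j * F z"
    by (intro mult_left_mono F_mono) (use z zj assms(2) in auto)
  also have "\<dots> \<le> t / z j * G"
    by (intro mult_left_mono) (use z zj assms(2) in auto)
  also have "\<dots> < 1 * G"
    by (intro mult_strict_right_mono) (use zj assms in auto)
  finally show False by simp
qed

end

section \<open>A single phase\<close>

lemma half_le_ln_one_plus:
  fixes s :: real
  assumes "0 \<le> s" "s \<le> 1"
  shows "s / 2 \<le> ln (1 + s)"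
proof -
  have "ln (1 / (1 + s)) \<le> 1 / (1 + s) - 1" by (rule ln_le_minus_one) (use assms in auto)
  also have "\<dots> \<le> - (s / 2)" using assms mult_right_mono[of s 1 s] by (simp add: field_simps)
  finally show ?thesis using assms by (simp add: ln_div)
qed

locale covering_phase = convex_posynomial +
  fixes G :: real and M :: nat and u :: "'b \<Rightarrow> real"
  assumes G_pos: "0 < G" and two_le_M: "2 \<le> M" and card_le_M: "card J \<le> M"
    and u_pos: "j \<in> J \<Longrightarrow> 0 < u j"
    and F_u: "j \<in> J \<Longrightarrow> F (\<lambda>i. if i = j then u j else 0) = G"
begin

definition \<delta> :: real where "\<delta> = 1 / (12 * real \<tau> * ln M)"

definition start :: "'b \<Rightarrow> real" where "start j = u j / M"

lemma ln_M: "1 / 2 \<le> ln (real M)"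
proof -
  have "1 / 2 \<le> ln (1 + 1 :: real)" by (rule half_le_ln_one_plus) auto
  also have "\<dots> \<le> ln (real M)" using two_le_M by (subst ln_le_cancel_iff) auto
  finally show ?thesis .
qed

lemma \<delta>_pos: "0 < \<delta>"
  using ln_M degree_pos by (auto simp: \<delta>_def)

lemma \<tau>_\<delta>: "\<tau> * \<delta> \<le> 1"
  using ln_M degree_pos by (simp add: \<delta>_def field_simps)

lemma \<delta>_le_1: "\<delta> \<le> 1"
proof -
  have "1 * \<delta> \<le> \<tau> * \<delta>" using degree_pos \<delta>_pos by (intro mult_right_mono) auto
  with \<tau>_\<delta> show ?thesis by simp
qed

lemma start_pos: "j \<in> J \<Longrightarrow> 0 < start j"
  using u_pos two_le_M by (simp add: start_def)

lemma start_le_u: "j \<in> J \<Longrightarrow> start j \<le> u j"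
  using u_pos[of j] two_le_M by (simp add: start_def field_simps)

text \<open>The start is the average of the \<open>M\<close> points \<open>u j\<close> on the axes (padded by copies of the
  origin), each of which has value at most \<open>G\<close>.\<close>

lemma F_start_le: "F start \<le> G"
proof -
  let ?g = "grad start"
  have pos: "\<And>j. j \<in> J \<Longrightarrow> 0 \<le> start j" using start_pos by (auto intro: less_imp_le)
  have axis: "?g j * u j - (\<Sum>i\<in>J. ?g i * start i) \<le> G - F start" if "j \<in> J" for j
  proof -
    have "(\<Sum>i\<in>J. ?g i * ((if i = j then u j else 0) - start i))
        \<le> F (\<lambda>i. if i = j then u j else 0) - F start"
      by (rule grad_le) (use pos u_pos that in \<open>auto intro: less_imp_le\<close>)
    then show ?thesis
      using finite_J that F_u[OF that]
      by (simp add: right_diff_distrib sum_subtractf if_distrib[where f = "\<lambda>t. _ * t"] cong: if_cong)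
  qed
  have "(\<Sum>j\<in>J. ?g j * u j - (\<Sum>i\<in>J. ?g i * start i)) \<le> (\<Sum>j\<in>J. G - F start)"
    by (rule sum_mono) (rule axis)
  moreover have "(\<Sum>j\<in>J. ?g j * u j) = M * (\<Sum>j\<in>J. ?g j * start j)"
    using two_le_M by (simp add: start_def sum_distrib_left)
  ultimately have 1: "(real M - card J) * (\<Sum>j\<in>J. ?g j * start j) \<le> card J * (G - F start)"
    by (simp add: sum_subtractf left_diff_distrib)
  have "F start \<le> (\<Sum>j\<in>J. ?g j * start j)"
    using grad_le[of start "\<lambda>_. 0"] pos F_zero by (simp add: sum_negf)
  then have "(real M - card J) * F start \<le> (real M - card J) * (\<Sum>j\<in>J. ?g j * start j)"
    using card_le_M by (intro mult_left_mono) auto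
  with 1 have "M * F start \<le> card J * G" by (simp add: algebra_simps)
  also have "\<dots> \<le> M * G" using card_le_M G_pos by (intro mult_right_mono) auto
  finally show ?thesis using two_le_M by simp
qed

text \<open>\<open>D\<close> is the dual value: it pays for the cost of \<open>\<delta>x\<close>, and for every competitor \<open>z \<in> Z\<close>
  it is bounded by the relative-entropy type expression on the right.\<close>

definition invariant :: "('b \<Rightarrow> real) set \<Rightarrow> ('b \<Rightarrow> real) \<Rightarrow> bool" where
  "invariant Z x \<longleftrightarrow> (\<forall>j\<in>J. start j \<le> x j \<and> x j \<le> 2 * u j) \<and>
    (\<exists>D. F (\<lambda>j. \<delta> * x j) \<le> F (\<lambda>j. \<delta> * start j) + 6 * \<delta> * D \<and>
      (\<forall>z\<in>Z. D \<le> (\<Sum>j\<in>J. z j * grad (\<lambda>j. \<delta> * x j) j * ln (x j / start j))))"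

lemma invariant_start: "invariant Z start"
  unfolding invariant_def
proof (intro conjI exI[of _ 0] ballI)
  fix j assume "j \<in> J"
  then show "start j \<le> 2 * u j" using start_le_u[of j] u_pos[of j] by simp
next
  fix z
  have "z j * grad (\<lambda>j. \<delta> * start j) j * ln (start j / start j) = 0" if "j \<in> J" for j
    using start_pos[OF that] by simp
  then show "0 \<le> (\<Sum>j\<in>J. z j * grad (\<lambda>j. \<delta> * start j) j * ln (start j / start j))"
    by (intro sum_nonneg) (simp only: order.refl)
qed auto

lemma invariant_ge_start: "invariant Z x \<Longrightarrow> j \<in> J \<Longrightarrow> start j \<le> x j"
  by (auto simp: invariant_def)

lemma invariant_antimono: "invariant Z x \<Longrightarrow> Z' \<subseteq> Z \<Longrightarrow> invariant Z' x"
  unfolding invariant_def by blast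

lemma invariant_imp_F_le:
  assumes "invariant Z x" "z \<in> Z" and z: "\<And>j. j \<in> J \<Longrightarrow> 0 \<le> z j" "F z \<le> G"
  shows "F x \<le> 2 * (12 * real \<tau> * ln M) ^ \<tau> * G"
proof -
  let ?x = "\<lambda>j. \<delta> * x j"
  define S where "S = (\<Sum>j\<in>J. grad ?x j * z j)"
  from assms(1,2) obtain D where
    x: "\<And>j. j \<in> J \<Longrightarrow> start j \<le> x j" "\<And>j. j \<in> J \<Longrightarrow> x j \<le> 2 * u j"
    and D: "F ?x \<le> F (\<lambda>j. \<delta> * start j) + 6 * \<delta> * D"
      "D \<le> (\<Sum>j\<in>J. z j * grad ?x j * ln (x j / start j))"
    by (auto simp: invariant_def)
  have xpos: "\<And>j. j \<in> J \<Longrightarrow> 0 < x j" using x start_pos by force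
  have xnn: "\<And>j. j \<in> J \<Longrightarrow> 0 \<le> ?x j" using xpos \<delta>_pos by (auto intro: less_imp_le)
  have ln_le: "ln (x j / start j) \<le> 2 * ln M" if "j \<in> J" for j
  proof -
    have "x j / start j \<le> 2 * u j / start j"
      using x(2)[OF that] start_pos[OF that] by (intro divide_right_mono) auto
    also have "\<dots> = 2 * M" using u_pos[OF that] two_le_M by (simp add: start_def field_simps)
    also have "\<dots> \<le> M * M" using two_le_M by simp
    finally have "ln (x j / start j) \<le> ln (real M * real M)"
      using xpos[OF that] start_pos[OF that] two_le_M by (subst ln_le_cancel_iff) auto
    then show ?thesis using two_le_M by (simp add: ln_mult)
  qed
  have "D \<le> (\<Sum>j\<in>J. z j * grad ?x j * (2 * ln M))"
    using D(2) ln_le z(1) grad_nonneg[of ?x, OF xnn]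
    by (elim order_trans) (intro sum_mono mult_left_mono mult_nonneg_nonneg, auto)
  also have "\<dots> = 2 * ln M * S" by (simp add: S_def sum_distrib_left algebra_simps)
  finally have "6 * \<delta> * D \<le> 6 * \<delta> * (2 * ln M * S)"
    using \<delta>_pos by (intro mult_left_mono) auto
  also have "\<dots> = S / \<tau>" using ln_M degree_pos by (simp add: \<delta>_def field_simps)
  finally have "F ?x \<le> F (\<lambda>j. \<delta> * start j) + S / \<tau>" using D(1) by simp
  also have "F (\<lambda>j. \<delta> * start j) \<le> \<delta> * F start"
    using start_pos \<delta>_pos \<delta>_le_1 by (intro F_shrink_le) (auto intro: less_imp_le)
  also have "\<dots> \<le> \<delta> * G" using F_start_le \<delta>_pos by (intro mult_left_mono) auto
  finally have "\<tau> * F ?x \<le> \<tau> * (\<delta> * G + S / \<tau>)" by (intro mult_left_mono) auto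
  also have "\<dots> = (\<tau> * \<delta>) * G + S" using degree_pos by (simp add: field_simps)
  also have "\<dots> \<le> 1 * G + S" using \<tau>_\<delta> G_pos by (intro add_right_mono mult_right_mono) auto
  finally have "\<tau> * F ?x \<le> G + S" by simp
  moreover have "S - (\<Sum>j\<in>J. grad ?x j * ?x j) \<le> F z - F ?x"
    using grad_le[of ?x z, OF xnn z(1)] by (simp add: S_def right_diff_distrib sum_subtractf)
  moreover have "(\<Sum>j\<in>J. grad ?x j * ?x j) \<le> \<tau> * F ?x" by (rule grad_Euler_le) (rule xnn)
  ultimately have F\<delta>: "F ?x \<le> 2 * G" using z(2) by simp
  have "F x = F (\<lambda>j. (1 / \<delta>) * ?x j)" using \<delta>_pos by (intro F_cong) simp
  also have "\<dots> \<le> (1 / \<delta>) ^ \<tau> * F ?x"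
    by (rule F_scale_le) (use xnn \<delta>_pos \<delta>_le_1 in auto)
  also have "\<dots> \<le> (1 / \<delta>) ^ \<tau> * (2 * G)" using F\<delta> \<delta>_pos by (intro mult_left_mono) auto
  finally show ?thesis by (simp add: \<delta>_def mult.assoc mult.left_commute)
qed

text \<open>Coordinates \<open>j\<close> with \<open>u j \<le> x j\<close> are frozen: there \<open>x\<close> already dominates every competitor,
  so the competitor satisfies the constraint that \<open>x\<close> leaves for the other coordinates. The
  factor \<open>1 + 1 / \<tau>\<close> keeps the growth of the gradient below \<open>exp 1\<close>.\<close>

lemma invariant_step:
  assumes inv: "invariant Z x" and "z0 \<in> Z" "covering_row a"
    and Z: "\<And>z j. z \<in> Z \<Longrightarrow> j \<in> J \<Longrightarrow> 0 \<le> z j \<and> z j \<le> u j"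
      "\<And>z. z \<in> Z \<Longrightarrow> 1 \<le> (\<Sum>j\<in>J. a j * z j)"
    and uncovered: "(\<Sum>j\<in>J. a j * x j) < 1"
  shows "\<exists>y. invariant Z y \<and> (\<forall>j\<in>J. x j \<le> y j) \<and> (\<exists>i\<in>J. y i = (1 + 1 / \<tau>) * x i)"
proof -
  let ?x = "\<lambda>j. \<delta> * x j"
  define g where "g = grad ?x"
  from inv obtain D where
    x: "\<And>j. j \<in> J \<Longrightarrow> start j \<le> x j" "\<And>j. j \<in> J \<Longrightarrow> x j \<le> 2 * u j"
    and D1: "F ?x \<le> F (\<lambda>j. \<delta> * start j) + 6 * \<delta> * D"
    and D2: "\<And>z. z \<in> Z \<Longrightarrow> D \<le> (\<Sum>j\<in>J. z j * g j * ln (x j / start j))"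
    by (auto simp: invariant_def g_def)
  have a: "\<And>j. j \<in> J \<Longrightarrow> 0 \<le> a j" using \<open>covering_row a\<close> by (auto simp: covering_row_def)
  have xpos: "\<And>j. j \<in> J \<Longrightarrow> 0 < x j" using x start_pos by force
  have \<delta>x: "\<And>j. j \<in> J \<Longrightarrow> 0 < ?x j" using xpos \<delta>_pos by auto
  have g: "\<And>j. j \<in> J \<Longrightarrow> 0 < g j" unfolding g_def using \<delta>x by (rule grad_pos)
  define A where "A = {j\<in>J. x j < u j}"
  have A: "A \<subseteq> J" "finite A" using finite_J by (auto simp: A_def)
  define r where "r = 1 - (\<Sum>j\<in>J - A. a j * x j)"
  have split: "(\<Sum>j\<in>J. a j * v j) = (\<Sum>j\<in>J - A. a j * v j) + (\<Sum>j\<in>A. a j * v j)" for v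
    using sum.subset_diff[OF A(1) finite_J] .
  have r_le: "r \<le> (\<Sum>j\<in>A. a j * z j)" if "z \<in> Z" for z
  proof -
    have "(\<Sum>j\<in>J - A. a j * z j) \<le> (\<Sum>j\<in>J - A. a j * x j)"
      using Z(1)[OF that] a by (intro sum_mono mult_left_mono) (force simp: A_def)+
    with Z(2)[OF that] split[of z] show ?thesis by (simp add: r_def)
  qed
  have le_r: "(\<Sum>j\<in>A. a j * x j) \<le> r" using uncovered split[of x] by (simp add: r_def)
  have "0 \<le> (\<Sum>j\<in>A. a j * x j)"
    using A a xpos by (intro sum_nonneg mult_nonneg_nonneg) (auto intro: less_imp_le)
  with uncovered split[of x] have "0 < r" by (simp add: r_def)
  have "\<exists>i\<in>A. 0 < a i"
  proof (rule ccontr)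
    assume "\<not> (\<exists>i\<in>A. 0 < a i)"
    then have "\<And>j. j \<in> A \<Longrightarrow> a j = 0" using a A(1) by force
    then have "(\<Sum>j\<in>A. a j * z0 j) = 0" by simp
    with r_le[OF \<open>z0 \<in> Z\<close>] \<open>0 < r\<close> show False by simp
  qed
  then obtain i0 where i0: "i0 \<in> A" "0 < a i0" by blast
  define m where "m = Max ((\<lambda>j. a j / g j) ` A)"
  have m_ge: "a j / g j \<le> m" if "j \<in> A" for j
    unfolding m_def using A that by (intro Max_ge) auto
  have "m \<in> (\<lambda>j. a j / g j) ` A" unfolding m_def using A i0 by (intro Max_in) auto
  then obtain i where i: "i \<in> A" "m = a i / g i" by blast
  have "0 < a i0 / g i0" using i0 A g by auto
  with m_ge[OF i0(1)] have "0 < m" by simp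
  define \<eta> where "\<eta> = 1 / (\<tau> * m)"
  have \<eta>: "0 < \<eta>" using \<open>0 < m\<close> degree_pos by (simp add: \<eta>_def)
  define s where "s j = (if j \<in> A then \<eta> * (a j / g j) else 0)" for j
  have s0: "0 \<le> s j" if "j \<in> J" for j
    using that \<eta> a g by (simp add: s_def less_imp_le)
  have s1: "s j \<le> 1 / \<tau>" for j
  proof (cases "j \<in> A")
    case True
    then have "s j \<le> \<eta> * m"
      using mult_left_mono[OF m_ge[OF True], of \<eta>] \<eta> by (simp add: s_def)
    also have "\<dots> = 1 / \<tau>" using \<open>0 < m\<close> by (simp add: \<eta>_def)
    finally show ?thesis .
  qed (simp add: s_def)
  have "s i = \<eta> * m" using i by (simp add: s_def)
  then have si: "s i = 1 / \<tau>" using \<open>0 < m\<close> by (simp add: \<eta>_def)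
  have s_le_1: "s j \<le> 1" for j using s1[of j] degree_pos by (simp add: order_trans)
  have gs: "g j * s j = (if j \<in> A then \<eta> * a j else 0)" if "j \<in> J" for j
    using g[OF that] by (simp add: s_def)
  have sum_gs: "(\<Sum>j\<in>J. v j * (g j * s j)) = \<eta> * (\<Sum>j\<in>A. a j * v j)" for v
  proof -
    have "(\<Sum>j\<in>J. v j * (g j * s j)) = (\<Sum>j\<in>J. if j \<in> A then \<eta> * (a j * v j) else 0)"
      by (intro sum.cong refl) (simp add: gs)
    also have "\<dots> = (\<Sum>j\<in>A. \<eta> * (a j * v j))"
      using A by (simp add: sum.inter_restrict[symmetric] finite_J Int_absorb1)
    finally show ?thesis by (simp add: sum_distrib_left)
  qed
  define y where "y j = (1 + s j) * x j" for j
  let ?y = "\<lambda>j. \<delta> * y j"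
  have xy: "x j \<le> y j" if "j \<in> J" for j
    using mult_right_mono[of 1 "1 + s j" "x j"] s0[OF that] xpos[OF that] by (simp add: y_def)
  have \<delta>y: "\<And>j. j \<in> J \<Longrightarrow> 0 \<le> ?y j" "\<And>j. j \<in> J \<Longrightarrow> ?x j \<le> ?y j"
    using xy xpos \<delta>_pos by (force intro: mult_nonneg_nonneg mult_left_mono)+
  have g_le: "g j \<le> grad ?y j" if "j \<in> J" for j
    unfolding g_def using \<delta>y(2) \<delta>x by (intro grad_mono) (auto intro: less_imp_le)
  have grad_y: "grad ?y j \<le> 3 * g j" if "j \<in> J" for j
  proof -
    have "grad ?y j \<le> grad (\<lambda>j. (1 + 1 / \<tau>) * ?x j) j"
    proof (rule grad_mono)
      fix l assume l: "l \<in> J"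
      have "(1 + s l) * ?x l \<le> (1 + 1 / \<tau>) * ?x l"
        using s1[of l] \<delta>x[OF l] by (intro mult_right_mono) auto
      then show "?y l \<le> (1 + 1 / \<tau>) * ?x l" by (simp add: y_def mult.left_commute)
    qed (rule \<delta>y(1))
    also have "\<dots> \<le> (1 + 1 / \<tau>) ^ \<tau> * g j"
      unfolding g_def using \<delta>x by (intro grad_scale_le) (auto intro: less_imp_le)
    also have "\<dots> \<le> 3 * g j"
      using exp_ge_one_plus_x_over_n_power_n[of \<tau> 1] exp_le degree_pos g[OF that]
      by (intro mult_right_mono) auto
    finally show ?thesis .
  qed
  have "F ?y - F ?x \<le> (\<Sum>j\<in>J. grad ?y j * (?y j - ?x j))"
    using grad_le[of ?y ?x] \<delta>y(1) \<delta>x by (simp add: right_diff_distrib sum_subtractf less_imp_le)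
  also have "\<dots> \<le> (\<Sum>j\<in>J. 3 * g j * (?y j - ?x j))"
    using \<delta>y(2) grad_y by (intro sum_mono mult_right_mono) auto
  also have "\<dots> = 3 * \<delta> * (\<Sum>j\<in>J. x j * (g j * s j))"
    by (simp add: y_def sum_distrib_left algebra_simps)
  also have "\<dots> = 3 * \<delta> * \<eta> * (\<Sum>j\<in>A. a j * x j)" by (simp add: sum_gs)
  also have "\<dots> \<le> 3 * \<delta> * \<eta> * r" using le_r \<eta> \<delta>_pos by (intro mult_left_mono) auto
  finally have cost: "F ?y \<le> F (\<lambda>j. \<delta> * start j) + 6 * \<delta> * (D + \<eta> * r / 2)"
    using D1 by (simp add: algebra_simps)
  have dual: "D + \<eta> * r / 2 \<le> (\<Sum>j\<in>J. z j * grad ?y j * ln (y j / start j))" if z: "z \<in> Z" for z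
  proof -
    have "\<eta> * r \<le> \<eta> * (\<Sum>j\<in>A. a j * z j)" using r_le[OF z] \<eta> by (intro mult_left_mono) auto
    also have "\<dots> = (\<Sum>j\<in>J. z j * (g j * s j))" by (simp add: sum_gs)
    finally have "D + \<eta> * r / 2 \<le> (\<Sum>j\<in>J. z j * g j * ln (x j / start j)) + (\<Sum>j\<in>J. z j * (g j * s j)) / 2"
      using D2[OF z] by simp
    also have "\<dots> = (\<Sum>j\<in>J. z j * g j * (ln (x j / start j) + s j / 2))"
      by (simp add: sum.distrib sum_divide_distrib algebra_simps)
    also have "\<dots> \<le> (\<Sum>j\<in>J. z j * grad ?y j * ln (y j / start j))"
    proof (rule sum_mono)
      fix j assume j: "j \<in> J"
      have nonneg: "0 \<le> ln (x j / start j)" using x(1)[OF j] start_pos[OF j] by simp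
      have "ln (x j / start j) + s j / 2 \<le> ln (x j / start j) + ln (1 + s j)"
        using half_le_ln_one_plus[OF s0[OF j] s_le_1] by simp
      also have "\<dots> = ln (x j / start j * (1 + s j))"
        using xpos[OF j] start_pos[OF j] s0[OF j] by (subst ln_mult) auto
      finally have "ln (x j / start j) + s j / 2 \<le> ln (y j / start j)"
        by (simp add: y_def mult.commute)
      then show "z j * g j * (ln (x j / start j) + s j / 2) \<le> z j * grad ?y j * ln (y j / start j)"
        using nonneg s0[OF j] Z(1)[OF z j] g[OF j] g_le[OF j]
        by (intro mult_mono mult_nonneg_nonneg) auto
    qed
    finally show ?thesis .
  qed
  have y_le: "y j \<le> 2 * u j" if "j \<in> J" for j
  proof (cases "j \<in> A")
    case True
    then have "(1 + s j) * x j \<le> 2 * u j"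
      using s_le_1[of j] xpos[OF that] by (intro mult_mono) (auto simp: A_def)
    then show ?thesis by (simp add: y_def)
  next
    case False
    then show ?thesis using x(2)[OF that] by (simp add: y_def s_def)
  qed
  have "invariant Z y"
    unfolding invariant_def using x(1) xy y_le cost dual by (blast intro: order_trans)
  with xy i A si show ?thesis by (intro exI[of _ y]) (auto simp: y_def)
qed

lemma invariant_cover:
  assumes inv: "invariant Z x" and "Z \<noteq> {}" "covering_row a"
    and Z: "\<And>z j. z \<in> Z \<Longrightarrow> j \<in> J \<Longrightarrow> 0 \<le> z j \<and> z j \<le> u j"
      "\<And>z. z \<in> Z \<Longrightarrow> 1 \<le> (\<Sum>j\<in>J. a j * z j)"
  shows "\<exists>y. invariant Z y \<and> (\<forall>j\<in>J. x j \<le> y j) \<and> 1 \<le> (\<Sum>j\<in>J. a j * y j)"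
proof -
  let ?q = "ln (1 + 1 / real \<tau>)" and ?\<Phi> = "\<lambda>x. \<Sum>j\<in>J. ln (2 * u j / x j)"
  have q: "0 < ?q" using degree_pos by (intro ln_gt_zero) simp
  have pos: "0 < y j" "y j \<le> 2 * u j" if "invariant Z y" "j \<in> J" for y j
    using that start_pos[of j] by (force simp: invariant_def)+
  have progress: "\<exists>y. invariant Z y \<and> (\<forall>j\<in>J. x j \<le> y j) \<and> ?\<Phi> y \<le> ?\<Phi> x - ?q"
    if inv: "invariant Z x" and uncovered: "(\<Sum>j\<in>J. a j * x j) < 1" for x
  proof -
    obtain z0 where "z0 \<in> Z" using \<open>Z \<noteq> {}\<close> by blast
    then obtain y i where y: "invariant Z y" "\<And>j. j \<in> J \<Longrightarrow> x j \<le> y j"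
      and i: "i \<in> J" "y i = (1 + 1 / \<tau>) * x i"
      using invariant_step[of Z x z0 a] inv \<open>covering_row a\<close> Z uncovered by blast
    have "2 * u i / y i = (2 * u i / x i) / (1 + 1 / \<tau>)" by (simp add: i(2) mult.commute)
    moreover have "0 < 1 + 1 / real \<tau>" by (simp add: add_pos_nonneg)
    ultimately have "ln (2 * u i / y i) = ln (2 * u i / x i) - ?q"
      using pos(1)[OF inv i(1)] u_pos[OF i(1)] by (simp only: ln_div zero_less_divide_iff) simp
    moreover have "(\<Sum>j\<in>J - {i}. ln (2 * u j / y j)) \<le> (\<Sum>j\<in>J - {i}. ln (2 * u j / x j))"
    proof (rule sum_mono)
      fix j assume "j \<in> J - {i}"
      then show "ln (2 * u j / y j) \<le> ln (2 * u j / x j)"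
        using pos[OF inv, of j] pos[OF y(1), of j] y(2)[of j] u_pos[of j]
        by (simp add: divide_left_mono)
    qed
    ultimately have "?\<Phi> y \<le> ?\<Phi> x - ?q"
      by (simp add: sum.remove[OF finite_J i(1)])
    with y show ?thesis by blast
  qed
  have "\<exists>y. invariant Z y \<and> (\<forall>j\<in>J. x j \<le> y j) \<and> 1 \<le> (\<Sum>j\<in>J. a j * y j)"
    if "invariant Z x" "?\<Phi> x \<le> real n * ?q" for n x
    using that
  proof (induction n arbitrary: x)
    case 0
    have "1 \<le> (\<Sum>j\<in>J. a j * x j)"
    proof (rule ccontr)
      assume "\<not> 1 \<le> (\<Sum>j\<in>J. a j * x j)"
      then obtain y where y: "invariant Z y" "?\<Phi> y \<le> ?\<Phi> x - ?q"
        using progress[OF 0(1)] by auto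
      have "0 \<le> ?\<Phi> y" using pos[OF y(1)] by (intro sum_nonneg) simp
      with y(2) 0(2) q show False by simp
    qed
    with 0 show ?case by blast
  next
    case (Suc n)
    show ?case
    proof (cases "1 \<le> (\<Sum>j\<in>J. a j * x j)")
      case True
      with Suc.prems show ?thesis by blast
    next
      case False
      then obtain y where y: "invariant Z y" "\<And>j. j \<in> J \<Longrightarrow> x j \<le> y j" "?\<Phi> y \<le> ?\<Phi> x - ?q"
        using progress[OF Suc.prems(1)] by auto
      have "?\<Phi> y \<le> real n * ?q" using y(3) Suc.prems(2) by (simp add: algebra_simps)
      from Suc.IH[OF y(1) this] y(2) show ?thesis by (blast intro: order_trans)
    qed
  qed
  moreover obtain n where "?\<Phi> x \<le> real n * ?q" using reals_Archimedean3[OF q] by (meson less_imp_le)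
  ultimately show ?thesis using inv by blast
qed

end

context convex_posynomial
begin

lemma phase_algorithm:
  assumes "0 < G" "2 \<le> M" "card J \<le> M"
  shows "\<exists>B. (\<forall>as. (\<forall>b\<in>set as. covering_row b) \<longrightarrow> (\<forall>j\<in>J. 0 \<le> B as j) \<and>
      (\<forall>z. covers as z \<and> F z \<le> G \<longrightarrow> F (B as) \<le> 2 * (12 * real \<tau> * ln M) ^ \<tau> * G)) \<and>
    (\<forall>as a. (\<forall>b\<in>set (as @ [a]). covering_row b) \<longrightarrow>
      (\<forall>j\<in>J. B as j \<le> B (as @ [a]) j) \<and> 1 \<le> (\<Sum>j\<in>J. a j * B (as @ [a]) j))"
proof -
  have "\<forall>j\<in>J. \<exists>t. 0 < t \<and> F (\<lambda>i. if i = j then t else 0) = G"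
    using axis_value_exists assms(1) by blast
  from bchoice[OF this] obtain u where u: "\<And>j. j \<in> J \<Longrightarrow> 0 < u j"
    "\<And>j. j \<in> J \<Longrightarrow> F (\<lambda>i. if i = j then u j else 0) = G" by blast
  interpret covering_phase K J c e \<tau> F G M u
    using assms u by unfold_locales auto
  define Z where "Z as = {z. covers as z \<and> (\<forall>j\<in>J. z j \<le> u j)}" for as
  define Q where "Q as x \<longleftrightarrow> (\<forall>j\<in>J. start j \<le> x j) \<and> (Z as \<noteq> {} \<longrightarrow> invariant (Z as) x)" for as x
  have "\<exists>B. (\<forall>as. (\<forall>b\<in>set as. covering_row b) \<longrightarrow> Q as (B as)) \<and>
    (\<forall>as a. (\<forall>b\<in>set (as @ [a]). covering_row b) \<longrightarrow>
      (\<forall>j\<in>J. B as j \<le> B (as @ [a]) j) \<and> 1 \<le> (\<Sum>j\<in>J. a j * B (as @ [a]) j))"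
  proof (rule online_choice[where ?s0.0 = start])
    show "Q [] start" by (simp add: Q_def invariant_start)
    fix as a x assume rows: "\<forall>b\<in>set (as @ [a]). covering_row b" and x: "Q as x"
    have Z_sub: "Z (as @ [a]) \<subseteq> Z as" by (auto simp: Z_def covers_def)
    show "\<exists>y. Q (as @ [a]) y \<and> (\<forall>j\<in>J. x j \<le> y j) \<and> 1 \<le> (\<Sum>j\<in>J. a j * y j)"
    proof (cases "Z (as @ [a]) = {}")
      case True
      have "\<exists>y. (\<forall>j\<in>J. x j \<le> y j) \<and> 1 \<le> (\<Sum>j\<in>J. a j * y j)"
        using rows x start_pos by (intro row_satisfiable) (force simp: Q_def)+
      then show ?thesis using True x unfolding Q_def by (meson order_trans)
    next
      case False
      have "invariant (Z (as @ [a])) x"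
        using x False Z_sub by (intro invariant_antimono[OF _ Z_sub]) (auto simp: Q_def)
      moreover have "0 \<le> z j \<and> z j \<le> u j" if "z \<in> Z (as @ [a])" "j \<in> J" for z j
        using that by (simp add: Z_def covers_def)
      moreover have "1 \<le> (\<Sum>j\<in>J. a j * z j)" if "z \<in> Z (as @ [a])" for z
        using that by (simp add: Z_def covers_def)
      moreover have "covering_row a" using rows by simp
      ultimately obtain y where
        y: "invariant (Z (as @ [a])) y" "\<forall>j\<in>J. x j \<le> y j" "1 \<le> (\<Sum>j\<in>J. a j * y j)"
        using invariant_cover[of "Z (as @ [a])" x a] False by blast
      moreover have "Q (as @ [a]) y" using y(1) by (simp add: Q_def invariant_ge_start)
      ultimately show ?thesis by blast
    qed
  qed
  then obtain B where B: "\<forall>as. (\<forall>b\<in>set as. covering_row b) \<longrightarrow> Q as (B as)"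
    and B_step: "\<forall>as a. (\<forall>b\<in>set (as @ [a]). covering_row b) \<longrightarrow>
      (\<forall>j\<in>J. B as j \<le> B (as @ [a]) j) \<and> 1 \<le> (\<Sum>j\<in>J. a j * B (as @ [a]) j)"
    by (elim exE conjE)
  have B: "Q as (B as)" if "\<forall>b\<in>set as. covering_row b" for as using B that by simp
  have "F (B as) \<le> 2 * (12 * real \<tau> * ln M) ^ \<tau> * G"
    if "\<forall>b\<in>set as. covering_row b" and z: "covers as z" "F z \<le> G" for as z
  proof -
    have z0: "\<And>j. j \<in> J \<Longrightarrow> 0 \<le> z j" using z by (simp add: covers_def)
    have "z \<in> Z as"
      using z z0 u le_axis_value[of _ _ G z] G_pos by (auto simp: Z_def)
    with B[OF that(1)] show ?thesis
      using invariant_imp_F_le[of "Z as" "B as" z] z0 z by (auto simp: Q_def)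
  qed
  moreover have "0 \<le> B as j" if "\<forall>b\<in>set as. covering_row b" "j \<in> J" for as j
    using B[OF that(1)] start_pos[OF that(2)] that(2) by (force simp: Q_def)
  ultimately show ?thesis using B_step by (intro exI[of _ B] conjI allI impI) auto
qed

section \<open>Guessing the optimum\<close>

lemma covers_exists:
  assumes "\<forall>b\<in>set as. covering_row b"
  shows "\<exists>z. covers as z"
  using assms
proof (induction as rule: rev_induct)
  case Nil
  show ?case by (intro exI[of _ "\<lambda>_. 0"]) (simp add: covers_def)
next
  case (snoc a as)
  then obtain z where z: "covers as z" by auto
  obtain y where y: "\<forall>j\<in>J. z j \<le> y j" "1 \<le> (\<Sum>j\<in>J. a j * y j)"
    using row_satisfiable[of a z] snoc.prems z by (auto simp: covers_def)
  have "1 \<le> (\<Sum>j\<in>J. b j * y j)" if "b \<in> set as" for b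
  proof -
    have "1 \<le> (\<Sum>j\<in>J. b j * z j)" using z that by (simp add: covers_def)
    also have "\<dots> \<le> (\<Sum>j\<in>J. b j * y j)"
      using snoc.prems that y(1) by (intro sum_mono mult_left_mono) (auto simp: covering_row_def)
    finally show ?thesis .
  qed
  with y z show ?case by (intro exI[of _ y]) (force simp: covers_def)
qed

lemma F_covers_lower_bound:
  assumes "covering_row a"
  shows "\<exists>b>0. \<forall>z. covers [a] z \<longrightarrow> b \<le> F z"
proof -
  have "\<forall>j\<in>J. \<exists>t. 0 < t \<and> F (\<lambda>i. if i = j then t else 0) = 1"
    using axis_value_exists[of _ 1] by auto
  from bchoice[OF this] obtain u where u: "\<And>j. j \<in> J \<Longrightarrow> 0 < u j"
    "\<And>j. j \<in> J \<Longrightarrow> F (\<lambda>i. if i = j then u j else 0) = 1" by blast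
  define S where "S = (\<Sum>j\<in>J. a j * u j)"
  have a: "\<And>j. j \<in> J \<Longrightarrow> 0 \<le> a j" using assms by (simp add: covering_row_def)
  have S: "0 \<le> S" unfolding S_def using a u by (intro sum_nonneg mult_nonneg_nonneg) (auto intro: less_imp_le)
  have "(1 / (S + 1)) ^ \<tau> \<le> F z" if z: "covers [a] z" for z
  proof (rule ccontr)
    assume "\<not> (1 / (S + 1)) ^ \<tau> \<le> F z"
    then have less: "F z \<le> (1 / (S + 1)) ^ \<tau>" by simp
    have z0: "\<And>j. j \<in> J \<Longrightarrow> 0 \<le> z j" using z by (simp add: covers_def)
    have "F (\<lambda>j. (S + 1) * z j) \<le> (S + 1) ^ \<tau> * F z"
      using z0 S by (intro F_scale_le) auto
    also have "\<dots> \<le> (S + 1) ^ \<tau> * (1 / (S + 1)) ^ \<tau>"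
      using less S by (intro mult_left_mono) auto
    also have "\<dots> = 1" using S by (simp add: power_one_over)
    finally have "F (\<lambda>j. (S + 1) * z j) \<le> 1" .
    then have "(S + 1) * z j \<le> u j" if "j \<in> J" for j
      using le_axis_value[OF that u(1)[OF that] u(2)[OF that], of "\<lambda>j. (S + 1) * z j"] z0 S by simp
    then have "(\<Sum>j\<in>J. a j * ((S + 1) * z j)) \<le> S"
      unfolding S_def using a by (intro sum_mono mult_left_mono) auto
    then have "(S + 1) * (\<Sum>j\<in>J. a j * z j) \<le> S"
      by (simp add: sum_distrib_left mult.left_commute)
    moreover have "(S + 1) * 1 \<le> (S + 1) * (\<Sum>j\<in>J. a j * z j)"
      using z S by (intro mult_left_mono) (auto simp: covers_def)
    ultimately show False by simp
  qed
  then show ?thesis using S by (intro exI[of _ "(1 / (S + 1)) ^ \<tau>"]) auto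
qed

text \<open>Phase \<open>k\<close> works with the guess \<open>2 powr (\<tau> * k)\<close> for the optimum. The algorithm adds the
  outputs of all phases; the factor \<open>2 ^ \<tau>\<close> between guesses absorbs the factor lost
  in \<open>F_add_le\<close>.\<close>

lemma competitive_algorithm:
  assumes "2 \<le> M" "card J \<le> M"
  shows "\<exists>A. (\<forall>as. (\<forall>b\<in>set as. covering_row b) \<longrightarrow> (\<forall>j\<in>J. 0 \<le> A as j) \<and>
      (\<forall>z. covers as z \<longrightarrow> F (A as) \<le> (96 * real \<tau> * ln M) ^ \<tau> * F z)) \<and>
    (\<forall>as a. (\<forall>b\<in>set (as @ [a]). covering_row b) \<longrightarrow>
      (\<forall>j\<in>J. A as j \<le> A (as @ [a]) j) \<and> 1 \<le> (\<Sum>j\<in>J. a j * A (as @ [a]) j))"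
proof -
  define R :: real where "R = 2 ^ \<tau>"
  have R: "2 \<le> R" using power_increasing[of 1 \<tau> "2::real"] degree_pos by (simp add: R_def)
  define \<alpha> where "\<alpha> = 2 * (12 * real \<tau> * ln M) ^ \<tau>"
  have \<alpha>: "0 \<le> \<alpha>" using assms(1) by (simp add: \<alpha>_def)
  define opt where "opt as = Inf (F ` {z. covers as z})" for as
  define k where "k as = \<lfloor>log R (opt as)\<rfloor> + 1" for as
  define G where "G i = R powr (of_int i)" for i :: int
  have G_pos: "0 < G i" for i using R by (simp add: G_def)
  have bdd: "bdd_below (F ` {z. covers as z})" for as
    using F_nonneg by (intro bdd_belowI2[of _ 0]) (auto simp: covers_def)
  have opt_le: "opt as \<le> F z" if "covers as z" for as z
    unfolding opt_def using that bdd by (intro cInf_lower) auto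
  have opt_pos: "0 < opt as" if rows: "\<forall>b\<in>set as. covering_row b" and "as \<noteq> []" for as
  proof -
    obtain b where b: "0 < b" "\<And>z. covers [hd as] z \<Longrightarrow> b \<le> F z"
      using F_covers_lower_bound[of "hd as"] rows \<open>as \<noteq> []\<close> by auto
    have "b \<le> opt as"
      unfolding opt_def using covers_exists[OF rows] b(2) \<open>as \<noteq> []\<close>
      by (intro cInf_greatest) (auto simp: covers_def)
    with b(1) show ?thesis by simp
  qed
  have opt_less: "opt as < G (k as)" and G_le: "G (k as) \<le> R * opt as"
    if rows: "\<forall>b\<in>set as. covering_row b" and "as \<noteq> []" for as
  proof -
    note pos = opt_pos[OF that]
    have powr: "R powr log R (opt as) = opt as" using pos R by simp
    have "R powr log R (opt as) < G (k as)"
      unfolding G_def using R by (intro powr_less_mono) (simp_all add: k_def floor_less_iff)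
    then show "opt as < G (k as)" by (simp only: powr)
    have "G (k as) \<le> R powr (1 + log R (opt as))"
      unfolding G_def using R by (intro powr_mono) (simp_all add: k_def)
    also have "\<dots> = R * opt as" using R powr by (simp add: powr_add)
    finally show "G (k as) \<le> R * opt as" .
  qed
  have k_mono: "k as \<le> k (as @ [a])" if rows: "\<forall>b\<in>set (as @ [a]). covering_row b" and "as \<noteq> []" for as a
  proof -
    have "opt as \<le> opt (as @ [a])"
      unfolding opt_def
    proof (rule cInf_superset_mono[OF _ bdd])
      show "F ` {z. covers (as @ [a]) z} \<noteq> {}" using covers_exists[OF rows] by auto
      show "F ` {z. covers (as @ [a]) z} \<subseteq> F ` {z. covers as z}" by (auto simp: covers_def)
    qed
    then show ?thesis
      using opt_pos[of as] that R by (auto simp: k_def intro!: floor_mono)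
  qed
  have G_less: "R * G i \<le> G l" if "i < l" for i l
  proof -
    have "R * G i = R powr (1 + of_int i)" using R by (simp add: G_def powr_add)
    also have "\<dots> \<le> G l" unfolding G_def using R that by (intro powr_mono) auto
    finally show ?thesis .
  qed
  have "\<exists>B. \<forall>i. (\<forall>as. (\<forall>b\<in>set as. covering_row b) \<longrightarrow> (\<forall>j\<in>J. 0 \<le> B i as j) \<and>
      (\<forall>z. covers as z \<and> F z \<le> G i \<longrightarrow> F (B i as) \<le> \<alpha> * G i)) \<and>
    (\<forall>as a. (\<forall>b\<in>set (as @ [a]). covering_row b) \<longrightarrow>
      (\<forall>j\<in>J. B i as j \<le> B i (as @ [a]) j) \<and> 1 \<le> (\<Sum>j\<in>J. a j * B i (as @ [a]) j))"
    unfolding \<alpha>_def by (rule choice, rule allI, rule phase_algorithm[OF G_pos assms])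
  then obtain B where B: "\<forall>i. (\<forall>as. (\<forall>b\<in>set as. covering_row b) \<longrightarrow> (\<forall>j\<in>J. 0 \<le> B i as j) \<and>
      (\<forall>z. covers as z \<and> F z \<le> G i \<longrightarrow> F (B i as) \<le> \<alpha> * G i)) \<and>
    (\<forall>as a. (\<forall>b\<in>set (as @ [a]). covering_row b) \<longrightarrow>
      (\<forall>j\<in>J. B i as j \<le> B i (as @ [a]) j) \<and> 1 \<le> (\<Sum>j\<in>J. a j * B i (as @ [a]) j))" ..
  have B_nonneg: "0 \<le> B i as j" if "\<forall>b\<in>set as. covering_row b" "j \<in> J" for i as j
    using B that by simp
  have B_le: "F (B i as) \<le> \<alpha> * G i" if "\<forall>b\<in>set as. covering_row b" "covers as z" "F z \<le> G i" for i as z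
    using conjunct1[OF spec[OF B, of i], rule_format, of as] that by auto
  have B_mono: "B i as j \<le> B i (as @ [a]) j" if "\<forall>b\<in>set (as @ [a]). covering_row b" "j \<in> J" for i as a j
    using conjunct2[OF spec[OF B, of i]] that by simp
  have B_covers: "1 \<le> (\<Sum>j\<in>J. a j * B i (as @ [a]) j)" if "\<forall>b\<in>set (as @ [a]). covering_row b" for i as a
    using conjunct2[OF spec[OF B, of i]] that by simp
  have B_cost: "F (B (k as) as) \<le> \<alpha> * G (k as)" if "\<forall>b\<in>set as. covering_row b" "as \<noteq> []" for as
  proof -
    have "\<exists>v\<in>F ` {z. covers as z}. v < G (k as)"
      using opt_less[OF that] covers_exists[OF that(1)] by (intro cInf_lessD) (auto simp: opt_def)
    then show ?thesis using B_le[OF that(1)] by (auto intro: less_imp_le)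
  qed
  define past where "past as x P \<longleftrightarrow> (\<forall>j\<in>J. 0 \<le> P j) \<and> (\<forall>j\<in>J. x j = P j + B (k as) as j) \<and>
    F P \<le> \<alpha> * G (k as)" for as x P
  define Q where "Q as x \<longleftrightarrow> (if as = [] then x = (\<lambda>_. 0) else \<exists>P. past as x P)" for as x
  have Q_nonneg: "0 \<le> x j" if "\<forall>b\<in>set as. covering_row b" "Q as x" "j \<in> J" for as x j
    using that B_nonneg[OF that(1,3)] by (auto simp: Q_def past_def split: if_splits)
  have Q_cost: "F x \<le> \<alpha> * (R * G (k as))" if rows: "\<forall>b\<in>set as. covering_row b" and x: "Q as x" and ne: "as \<noteq> []" for as x
  proof -
    obtain P where P: "past as x P" using x ne by (auto simp: Q_def)
    have "F x = F (\<lambda>j. P j + B (k as) as j)" using P by (intro F_cong) (auto simp: past_def)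
    also have "\<dots> \<le> R / 2 * (F P + F (B (k as) as))"
      unfolding R_def using P B_nonneg[OF rows] by (intro F_add_le) (auto simp: past_def)
    also have "\<dots> \<le> R / 2 * (\<alpha> * G (k as) + \<alpha> * G (k as))"
      using P B_cost[OF rows ne] R by (intro mult_left_mono add_mono) (auto simp: past_def)
    finally show ?thesis by (simp add: algebra_simps)
  qed
  have "\<exists>A. (\<forall>as. (\<forall>b\<in>set as. covering_row b) \<longrightarrow> Q as (A as)) \<and>
    (\<forall>as a. (\<forall>b\<in>set (as @ [a]). covering_row b) \<longrightarrow>
      (\<forall>j\<in>J. A as j \<le> A (as @ [a]) j) \<and> 1 \<le> (\<Sum>j\<in>J. a j * A (as @ [a]) j))"
  proof (rule online_choice[where ?s0.0 = "\<lambda>_. 0"])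
    show "Q [] (\<lambda>_. 0)" by (simp add: Q_def)
    fix as a x assume rows: "\<forall>b\<in>set (as @ [a]). covering_row b" and x: "Q as x"
    let ?as = "as @ [a]"
    have rows': "\<forall>b\<in>set as. covering_row b" using rows by simp
    have "\<exists>P. (\<forall>j\<in>J. 0 \<le> P j \<and> x j \<le> P j + B (k ?as) ?as j) \<and> F P \<le> \<alpha> * G (k ?as)"
    proof (cases "as \<noteq> [] \<and> k ?as = k as")
      case True
      then show ?thesis using x B_mono[OF rows] by (fastforce simp: Q_def past_def)
    next
      case False
      have "F x \<le> \<alpha> * G (k ?as)"
      proof (cases "as = []")
        case True
        then show ?thesis using x F_zero \<alpha> G_pos[of "k ?as"] by (simp add: Q_def)
      next
        case as: False
        then have "k as < k ?as" using False k_mono[OF rows as] by simp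
        then have "\<alpha> * (R * G (k as)) \<le> \<alpha> * G (k ?as)"
          using G_less \<alpha> by (intro mult_left_mono) auto
        with Q_cost[OF rows' x as] show ?thesis by simp
      qed
      then show ?thesis
        using Q_nonneg[OF rows' x] B_nonneg[OF rows] by (intro exI[of _ x]) auto
    qed
    then obtain P where P: "\<And>j. j \<in> J \<Longrightarrow> 0 \<le> P j"
      "\<And>j. j \<in> J \<Longrightarrow> x j \<le> P j + B (k ?as) ?as j" "F P \<le> \<alpha> * G (k ?as)" by blast
    let ?y = "\<lambda>j. P j + B (k ?as) ?as j"
    have "1 \<le> (\<Sum>j\<in>J. a j * B (k ?as) ?as j)" by (rule B_covers[OF rows])
    also have "\<dots> \<le> (\<Sum>j\<in>J. a j * ?y j)"
      using P(1) rows by (intro sum_mono mult_left_mono) (auto simp: covering_row_def)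
    finally have "1 \<le> (\<Sum>j\<in>J. a j * ?y j)" .
    moreover have "past ?as ?y P" using P by (simp add: past_def)
    then have "Q ?as ?y" by (auto simp: Q_def)
    ultimately show "\<exists>y. Q ?as y \<and> (\<forall>j\<in>J. x j \<le> y j) \<and> 1 \<le> (\<Sum>j\<in>J. a j * y j)"
      using P(2) by (intro exI[of _ ?y]) simp
  qed
  then obtain A where A: "\<forall>as. (\<forall>b\<in>set as. covering_row b) \<longrightarrow> Q as (A as)"
    and A_step: "\<forall>as a. (\<forall>b\<in>set (as @ [a]). covering_row b) \<longrightarrow>
      (\<forall>j\<in>J. A as j \<le> A (as @ [a]) j) \<and> 1 \<le> (\<Sum>j\<in>J. a j * A (as @ [a]) j)"
    by (elim exE conjE)
  have A: "Q as (A as)" if "\<forall>b\<in>set as. covering_row b" for as using A that by simp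
  have ratio: "\<alpha> * (R * R) \<le> (96 * real \<tau> * ln M) ^ \<tau>"
  proof -
    have "\<alpha> * (R * R) \<le> R * (12 * real \<tau> * ln M) ^ \<tau> * (R * R)"
      unfolding \<alpha>_def using R assms(1) by (intro mult_right_mono) auto
    also have "\<dots> = (2 * (12 * real \<tau> * ln M) * (2 * 2)) ^ \<tau>"
      by (simp only: R_def power_mult_distrib)
    finally show ?thesis by (simp add: algebra_simps)
  qed
  have cost: "F (A as) \<le> (96 * real \<tau> * ln M) ^ \<tau> * F z"
    if rows: "\<forall>b\<in>set as. covering_row b" and z: "covers as z" for as z
  proof -
    have Fz: "0 \<le> F z" using z by (intro F_nonneg) (simp add: covers_def)
    show ?thesis
    proof (cases "as = []")
      case True
      then show ?thesis using A[OF rows] Fz F_zero assms(1) by (simp add: Q_def)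
    next
      case False
      have "F (A as) \<le> \<alpha> * (R * G (k as))" using A[OF rows] False rows by (intro Q_cost) auto
      also have "\<dots> \<le> \<alpha> * (R * (R * F z))"
        using G_le[OF rows False] opt_le[OF z] \<alpha> R
        by (intro mult_left_mono) (auto intro: order_trans mult_left_mono)
      also have "\<dots> = \<alpha> * (R * R) * F z" by simp
      also have "\<dots> \<le> (96 * real \<tau> * ln M) ^ \<tau> * F z" using ratio Fz by (rule mult_right_mono)
      finally show ?thesis .
    qed
  qed
  show ?thesis
    using Q_nonneg[OF _ A] cost A_step by (intro exI[of _ A] conjI allI impI) simp_all
qed

text \<open>For a variable \<open>j\<close> the polynomial does not vanish on the axis of \<open>j\<close>, so some monomial is
  a pure power of that variable.\<close>

lemma card_J_le_card_K: "card J \<le> card K"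
proof -
  have "\<exists>k\<in>K. 0 < e k j \<and> (\<forall>i\<in>J. i \<noteq> j \<longrightarrow> e k i = 0)" if j: "j \<in> J" for j
  proof -
    obtain t where "F (\<lambda>i. if i = j then t else 0) = 1"
      using axis_value_exists[OF j, of 1] by auto
    then obtain k where k: "k \<in> K" "(\<Prod>i\<in>J. (if i = j then t else 0) ^ e k i) \<noteq> 0"
      unfolding F_def by (metis (no_types, lifting) mult_zero_right sum.neutral zero_neq_one)
    have "e k i = 0" if "i \<in> J" "i \<noteq> j" for i
      using k(2) that finite_J by (auto simp: prod_zero_iff split: if_splits)
    then show ?thesis using k(1) non_constant[OF k(1)] by (metis not_gr_zero)
  qed
  then obtain f where f: "\<And>j. j \<in> J \<Longrightarrow> f j \<in> K \<and> 0 < e (f j) j \<and> (\<forall>i\<in>J. i \<noteq> j \<longrightarrow> e (f j) i = 0)"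
    by metis
  have "inj_on f J" using f by (intro inj_onI) (metis less_irrefl)
  then show ?thesis using f finite_K by (intro card_inj_on_le[of f]) auto
qed

end

section \<open>From functions to vectors and multivariate polynomials\<close>

definition mpoly_vars :: "real_mpoly \<Rightarrow> nat set" where
  "mpoly_vars p = (\<Union>d\<in>Poly_Mapping.keys p. Poly_Mapping.keys d)"

definition mpoly_fun :: "real_mpoly \<Rightarrow> (nat \<Rightarrow> real) \<Rightarrow> real" where
  "mpoly_fun p x = (\<Sum>d\<in>Poly_Mapping.keys p. Poly_Mapping.lookup p d *
     (\<Prod>i\<in>mpoly_vars p. x i ^ Poly_Mapping.lookup d i))"

lemma finite_mpoly_vars: "finite (mpoly_vars p)"
  by (simp add: mpoly_vars_def)

lemma prod_mpoly_vars:
  assumes "d \<in> Poly_Mapping.keys p"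
  shows "(\<Prod>i\<in>mpoly_vars p. x i ^ Poly_Mapping.lookup d i)
    = (\<Prod>i\<in>Poly_Mapping.keys d. (x i :: real) ^ Poly_Mapping.lookup d i)"
  using assms finite_mpoly_vars[of p]
  by (intro prod.mono_neutral_right) (auto simp: mpoly_vars_def in_keys_iff)

lemma mpoly_eval_eq: "mpoly_eval p x = mpoly_fun p (\<lambda>i. x $ i)"
  unfolding mpoly_eval_def mpoly_fun_def by (intro sum.cong refl) (simp add: prod_mpoly_vars)

lemma mem_orthant_iff: "x \<in> orthant n \<longleftrightarrow> dim_vec x = n \<and> (\<forall>i<n. 0 \<le> x $ i)"
  unfolding orthant_def less_eq_vec_def carrier_vec_def by (safe; simp)

lemma convex_posynomial_mpoly:
  assumes vars: "in_variables n p" and nonneg: "nonneg_coeffs p"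
    and conv: "convex_on_orthant n (mpoly_eval p)"
    and deg: "max_degree p = \<tau>" "1 \<le> \<tau>" and zero: "mpoly_eval p (0\<^sub>v n) = 0"
  shows "convex_posynomial (Poly_Mapping.keys p) (mpoly_vars p) (Poly_Mapping.lookup p)
    Poly_Mapping.lookup \<tau> (mpoly_fun p)"
proof
  have sub: "mpoly_vars p \<subseteq> {..<n}" using vars by (auto simp: in_variables_def mpoly_vars_def)
  have pos: "0 < Poly_Mapping.lookup p d" if "d \<in> Poly_Mapping.keys p" for d
  proof -
    have "Poly_Mapping.lookup p d \<noteq> 0" using that by (simp add: in_keys_iff)
    moreover have "0 \<le> Poly_Mapping.lookup p d" using nonneg by (simp add: nonneg_coeffs_def)
    ultimately show ?thesis by simp
  qed
  show "mpoly_fun p x = (\<Sum>k\<in>Poly_Mapping.keys p. Poly_Mapping.lookup p k *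
      (\<Prod>j\<in>mpoly_vars p. x j ^ Poly_Mapping.lookup k j))" for x
    by (simp add: mpoly_fun_def)
  show "finite (Poly_Mapping.keys p)" "finite (mpoly_vars p)" by (auto simp: finite_mpoly_vars)
  show "0 < Poly_Mapping.lookup p k" if "k \<in> Poly_Mapping.keys p" for k using pos that .
  show "(\<Sum>j\<in>mpoly_vars p. Poly_Mapping.lookup k j) \<le> \<tau>" if k: "k \<in> Poly_Mapping.keys p" for k
  proof -
    have "(\<Sum>j\<in>mpoly_vars p. Poly_Mapping.lookup k j) = exponent_degree k"
      unfolding exponent_degree_def using k finite_mpoly_vars[of p]
      by (intro sum.mono_neutral_right) (auto simp: mpoly_vars_def in_keys_iff)
    also have "\<dots> \<le> \<tau>" unfolding deg(1)[symmetric] max_degree_def using k by (intro Max_ge) auto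
    finally show ?thesis .
  qed
  show "\<exists>j\<in>mpoly_vars p. 0 < Poly_Mapping.lookup k j" if k: "k \<in> Poly_Mapping.keys p" for k
  proof (rule ccontr)
    assume "\<not> ?thesis"
    then have one: "(\<Prod>j\<in>mpoly_vars p. 0 ^ Poly_Mapping.lookup k j) = (1 :: real)"
      by (intro prod.neutral) auto
    have "0 < mpoly_fun p (\<lambda>_. 0)"
      unfolding mpoly_fun_def
    proof (rule sum_pos2[OF _ k])
      show "0 < Poly_Mapping.lookup p k * (\<Prod>j\<in>mpoly_vars p. 0 ^ Poly_Mapping.lookup k j)"
        using one pos[OF k] by simp
      show "0 \<le> Poly_Mapping.lookup p d * (\<Prod>j\<in>mpoly_vars p. 0 ^ Poly_Mapping.lookup d j)"
        if "d \<in> Poly_Mapping.keys p" for d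
        using pos[OF that] by (intro mult_nonneg_nonneg prod_nonneg) auto
    qed simp
    moreover have "mpoly_fun p (\<lambda>_. 0) = mpoly_eval p (0\<^sub>v n)"
      unfolding mpoly_eval_eq mpoly_fun_def using sub
      by (intro sum.cong refl arg_cong2[of _ _ _ _ "(*)"] prod.cong) auto
    ultimately show False using zero by simp
  qed
  show "\<exists>k\<in>Poly_Mapping.keys p. 0 < Poly_Mapping.lookup k j" if "j \<in> mpoly_vars p" for j
    using that by (auto simp: mpoly_vars_def in_keys_iff)
  show "1 \<le> \<tau>" by fact
  fix x y :: "nat \<Rightarrow> real" and u v :: real
  assume xy: "\<And>j. j \<in> mpoly_vars p \<Longrightarrow> 0 \<le> x j" "\<And>j. j \<in> mpoly_vars p \<Longrightarrow> 0 \<le> y j"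
    and uv: "0 \<le> u" "0 \<le> v" "u + v = 1"
  define V where "V z = vec n (\<lambda>i. if i \<in> mpoly_vars p then z i else 0)" for z :: "nat \<Rightarrow> real"
  have cong: "mpoly_eval p w = mpoly_fun p z" if "\<And>i. i \<in> mpoly_vars p \<Longrightarrow> w $ i = z i" for w z
    unfolding mpoly_eval_eq mpoly_fun_def
    by (intro sum.cong refl arg_cong2[of _ _ _ _ "(*)"] prod.cong) (simp add: that)
  have "V x \<in> orthant n" "V y \<in> orthant n" using xy by (auto simp: mem_orthant_iff V_def)
  then have "mpoly_eval p (u \<cdot>\<^sub>v V x + v \<cdot>\<^sub>v V y) \<le> u * mpoly_eval p (V x) + v * mpoly_eval p (V y)"
    using conv uv unfolding convex_on_orthant_def by blast
  moreover have "mpoly_eval p (V z) = mpoly_fun p z" for z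
    using sub by (intro cong) (auto simp: V_def)
  moreover have "mpoly_eval p (u \<cdot>\<^sub>v V x + v \<cdot>\<^sub>v V y) = mpoly_fun p (\<lambda>j. u * x j + v * y j)"
    using sub by (intro cong) (auto simp: V_def)
  ultimately show "mpoly_fun p (\<lambda>j. u * x j + v * y j) \<le> u * mpoly_fun p x + v * mpoly_fun p y"
    by simp
qed

lemma orthant_positive_entry:
  assumes "a \<in> orthant n" "a \<noteq> 0\<^sub>v n"
  shows "\<exists>i<n. 0 < a $ i"
  using assms by (metis eq_vecI index_zero_vec mem_orthant_iff order_le_less)

lemma feasible_nonempty:
  assumes "as \<in> covering_instances n"
  shows "feasible n as \<noteq> {}"
proof -
  let ?x = "vec n (\<lambda>i. \<Sum>a\<leftarrow>as. 1 / a $ i)"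
  have nonneg: "0 \<le> 1 / a $ i" if "a \<in> set as" "i < n" for a i
    using that assms by (auto simp: covering_instances_def mem_orthant_iff)
  have "1 \<le> a \<bullet> ?x" if a: "a \<in> set as" for a
  proof -
    have an: "a \<in> orthant n" "a \<noteq> 0\<^sub>v n" using a assms by (auto simp: covering_instances_def)
    then obtain i where i: "i < n" "0 < a $ i" using orthant_positive_entry by blast
    have "1 / a $ i \<le> (\<Sum>a\<leftarrow>as. 1 / a $ i)"
      using a nonneg i by (intro member_le_sum_list) auto
    then have "1 \<le> a $ i * ?x $ i" using i by (simp add: field_simps)
    also have "\<dots> \<le> a \<bullet> ?x"
      unfolding scalar_prod_def using i an nonneg
      by (intro member_le_sum) (auto simp: mem_orthant_iff intro!: mult_nonneg_nonneg sum_list_nonneg)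
    finally show ?thesis .
  qed
  then have "?x \<in> feasible n as"
    using nonneg by (auto simp: feasible_def mem_orthant_iff intro!: sum_list_nonneg)
  then show ?thesis by blast
qed

text \<open>A vector with a positive entry outside \<open>mpoly_vars p\<close> is covered for free by raising that
  coordinate; \<open>1 / a $ i\<close> is the amount needed, and it is \<open>0\<close> if \<open>a $ i = 0\<close>.\<close>

lemma mpoly_competitive:
  assumes vars: "in_variables n p" and nonneg: "nonneg_coeffs p"
    and conv: "convex_on_orthant n (mpoly_eval p)"
    and deg: "max_degree p = \<tau>" "1 \<le> \<tau>" and zero: "mpoly_eval p (0\<^sub>v n) = 0"
    and M: "2 \<le> M" "card (mpoly_vars p) \<le> M"
  shows "\<exists>A. competitive n (mpoly_eval p) ((96 * real \<tau> * ln (real M)) ^ \<tau>) A"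
proof -
  let ?J = "mpoly_vars p" and ?\<alpha> = "(96 * real \<tau> * ln (real M)) ^ \<tau>"
  interpret convex_posynomial "Poly_Mapping.keys p" ?J "Poly_Mapping.lookup p"
    Poly_Mapping.lookup \<tau> "mpoly_fun p"
    using vars nonneg conv deg zero by (rule convex_posynomial_mpoly)
  have sub: "?J \<subseteq> {..<n}" using vars by (auto simp: in_variables_def mpoly_vars_def)
  have \<alpha>: "0 < ?\<alpha>" using M(1) deg(2) by (intro zero_less_power mult_pos_pos) auto
  from competitive_algorithm[OF M] obtain B where
    B: "\<forall>as. (\<forall>b\<in>set as. covering_row b) \<longrightarrow> (\<forall>j\<in>?J. 0 \<le> B as j) \<and>
      (\<forall>z. covers as z \<longrightarrow> mpoly_fun p (B as) \<le> ?\<alpha> * mpoly_fun p z)"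
    and B_step: "\<forall>as a. (\<forall>b\<in>set (as @ [a]). covering_row b) \<longrightarrow>
      (\<forall>j\<in>?J. B as j \<le> B (as @ [a]) j) \<and> 1 \<le> (\<Sum>j\<in>?J. a j * B (as @ [a]) j)"
    by (elim exE conjE)
  define proper where "proper a \<longleftrightarrow> (\<forall>i<n. i \<notin> ?J \<longrightarrow> a $ i = 0)" for a :: "real vec"
  define rows where "rows as = map (\<lambda>a i. a $ i) (filter proper as)" for as :: "real vec list"
  define A where "A as = vec n (\<lambda>i. if i \<in> ?J then B (rows as) i else \<Sum>a\<leftarrow>as. 1 / a $ i)" for as
  have covering_row: "covering_row (\<lambda>i. a $ i)" if a: "a \<in> orthant n" "a \<noteq> 0\<^sub>v n" "proper a" for a
  proof -
    obtain i where "i < n" "0 < a $ i" using orthant_positive_entry[OF a(1,2)] by blast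
    then have "i \<in> ?J" using a(3) by (auto simp: proper_def)
    then show ?thesis
      using a(1) sub \<open>0 < a $ i\<close> by (auto simp: covering_row_def mem_orthant_iff)
  qed
  have rows: "\<forall>b\<in>set (rows as). covering_row b" if "as \<in> covering_instances n" for as
    using that covering_row by (auto simp: rows_def covering_instances_def)
  have inv_nonneg: "0 \<le> 1 / a $ i" if "as \<in> covering_instances n" "a \<in> set as" "i < n" for a i as
    using that by (auto simp: covering_instances_def mem_orthant_iff)
  have B_nonneg: "0 \<le> B (rows as) i" if "as \<in> covering_instances n" "i \<in> ?J" for as i
    using B rows[OF that(1)] that(2) by simp
  have A_nonneg: "A as \<in> orthant n" if as: "as \<in> covering_instances n" for as
    using B_nonneg[OF as] inv_nonneg[OF as]
    by (auto simp: mem_orthant_iff A_def intro!: sum_list_nonneg)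
  have prefix: "as \<in> covering_instances n" if "as @ [a] \<in> covering_instances n" for as a
    using that by (simp add: covering_instances_def)
  have mono: "A as \<le> A (as @ [a])" if as: "as @ [a] \<in> covering_instances n" for as a
  proof -
    have "B (rows as) i \<le> B (rows (as @ [a])) i" if "i \<in> ?J" for i
      using B_step rows[OF as] that by (cases "proper a") (auto simp: rows_def)
    moreover have "0 \<le> 1 / a $ i" if "i < n" for i using inv_nonneg[OF as _ that, of a] by simp
    ultimately show ?thesis by (auto simp: less_eq_vec_def A_def)
  qed
  have covered: "1 \<le> a \<bullet> A (as @ [a])" if as: "as @ [a] \<in> covering_instances n" for as a
  proof -
    have a: "dim_vec a = n" "\<And>i. i < n \<Longrightarrow> 0 \<le> a $ i"
      using as by (auto simp: covering_instances_def mem_orthant_iff)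
    have A: "dim_vec (A (as @ [a])) = n" "\<And>i. i < n \<Longrightarrow> 0 \<le> A (as @ [a]) $ i"
      using A_nonneg[OF as] by (auto simp: mem_orthant_iff)
    show ?thesis
    proof (cases "proper a")
      case True
      then have "rows (as @ [a]) = rows as @ [\<lambda>i. a $ i]" by (simp add: rows_def)
      then have "1 \<le> (\<Sum>j\<in>?J. a $ j * B (rows (as @ [a])) j)" using B_step rows[OF as] by simp
      also have "\<dots> = (\<Sum>j\<in>?J. a $ j * A (as @ [a]) $ j)"
        using sub by (intro sum.cong) (auto simp: A_def)
      also have "\<dots> \<le> a \<bullet> A (as @ [a])"
        unfolding scalar_prod_def A(1) using sub a A by (intro sum_mono2) auto
      finally show ?thesis .
    next
      case False
      then obtain i where i: "i < n" "i \<notin> ?J" "a $ i \<noteq> 0" by (auto simp: proper_def)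
      then have "0 < a $ i" using a(2)[of i] by simp
      have "0 \<le> (\<Sum>b\<leftarrow>as. 1 / b $ i)"
        using inv_nonneg[OF prefix[OF as]] i by (intro sum_list_nonneg) auto
      then have "1 \<le> a $ i * A (as @ [a]) $ i"
        using i \<open>0 < a $ i\<close> by (simp add: A_def distrib_left)
      also have "\<dots> \<le> a \<bullet> A (as @ [a])"
        unfolding scalar_prod_def A(1) using i a A by (intro member_le_sum) auto
      finally show ?thesis .
    qed
  qed
  have cost: "mpoly_eval p (A as) \<le> ?\<alpha> * opt_cost n (mpoly_eval p) as"
    if as: "as \<in> covering_instances n" for as
  proof -
    have "mpoly_eval p (A as) / ?\<alpha> \<le> mpoly_eval p z" if z: "z \<in> feasible n as" for z
    proof -
      have z0: "dim_vec z = n" "\<And>i. i < n \<Longrightarrow> 0 \<le> z $ i"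
        using z by (auto simp: feasible_def mem_orthant_iff)
      have "1 \<le> (\<Sum>j\<in>?J. a $ j * z $ j)" if a: "a \<in> set as" "proper a" for a
      proof -
        have "1 \<le> a \<bullet> z" using z a by (simp add: feasible_def)
        also have "\<dots> = (\<Sum>j\<in>?J. a $ j * z $ j)"
          unfolding scalar_prod_def z0(1) using sub a(2)
          by (intro sum.mono_neutral_right) (auto simp: proper_def)
        finally show ?thesis .
      qed
      then have "covers (rows as) (\<lambda>i. z $ i)"
        using z0 sub by (auto simp: covers_def rows_def)
      then have "mpoly_fun p (B (rows as)) \<le> ?\<alpha> * mpoly_fun p (\<lambda>i. z $ i)"
        using B rows[OF as] by simp
      moreover have "mpoly_eval p (A as) = mpoly_fun p (B (rows as))"
        unfolding mpoly_eval_eq using sub by (intro F_cong) (auto simp: A_def)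
      ultimately show ?thesis using \<alpha> by (simp add: mpoly_eval_eq field_simps)
    qed
    then have "mpoly_eval p (A as) / ?\<alpha> \<le> opt_cost n (mpoly_eval p) as"
      unfolding opt_cost_def using feasible_nonempty[OF as] by (intro cINF_greatest) auto
    then show ?thesis using \<alpha> by (simp add: field_simps)
  qed
  have "competitive n (mpoly_eval p) ?\<alpha> A"
    unfolding competitive_def online_algorithm_def using A_nonneg mono covered cost by blast
  then show ?thesis by blast
qed

theorem theorem1p1:
  shows "\<exists>c::real. c > 0 \<and>
    (\<forall>(n::nat) (\<tau>::nat) (p::real_mpoly).
       in_variables n p \<longrightarrow>
       nonneg_coeffs p \<longrightarrow>
       convex_on_orthant n (mpoly_eval p) \<longrightarrow>
       max_degree p = \<tau> \<longrightarrow>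
       \<tau> \<ge> 1 \<longrightarrow>
       mpoly_eval p (0\<^sub>v n) = 0 \<longrightarrow>
       (homogeneous \<tau> p \<and> n \<ge> 2 \<longrightarrow>
          (\<exists>A. competitive n (mpoly_eval p) ((c * real \<tau> * ln (real n)) ^ \<tau>) A)) \<and>
       (\<forall>N::nat. num_monomials p = N \<and> N \<ge> 2 \<longrightarrow>
          (\<exists>A. competitive n (mpoly_eval p) ((c * real \<tau> * ln (real N)) ^ \<tau>) A)))"
proof (intro exI[of _ 96] conjI allI impI)
  fix n \<tau> N :: nat and p :: real_mpoly
  assume p: "in_variables n p" "nonneg_coeffs p" "convex_on_orthant n (mpoly_eval p)"
    "max_degree p = \<tau>" "1 \<le> \<tau>" "mpoly_eval p (0\<^sub>v n) = 0"
  {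
    assume "homogeneous \<tau> p \<and> 2 \<le> n"
    moreover have "card (mpoly_vars p) \<le> card {..<n}"
      using p(1) by (intro card_mono) (auto simp: in_variables_def mpoly_vars_def)
    ultimately show "\<exists>A. competitive n (mpoly_eval p) ((96 * real \<tau> * ln (real n)) ^ \<tau>) A"
      using mpoly_competitive[OF p] by simp
  }
  assume N: "num_monomials p = N \<and> 2 \<le> N"
  interpret convex_posynomial "Poly_Mapping.keys p" "mpoly_vars p" "Poly_Mapping.lookup p"
    Poly_Mapping.lookup \<tau> "mpoly_fun p"
    using p by (rule convex_posynomial_mpoly)
  show "\<exists>A. competitive n (mpoly_eval p) ((96 * real \<tau> * ln (real N)) ^ \<tau>) A"
    using mpoly_competitive[OF p] N card_J_le_card_K by (simp add: num_monomials_def)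
qed simp

end
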